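(* There exist a representation $\rho_0\in\mathcal K_2$ and a neighborhood $\mathcal V$ of $\rho_0$ in the usual topology of $X_2=\mathrm{Hom}(F_2,\mathrm{PSL}(3,\mathbb C))$ such that, for every $\rho\in\mathcal V\cap\mathcal K_2$, the group $\rho(F_2)$ is nilpotent. In particular, $\mathcal V\cap\mathcal U_2=\varnothing$. Consequently $\mathcal U_2$, although Zariski dense in $X_2$, is not dense in $\mathcal K_2$ for the usual topology.
   Context: $F_2$ is the free group on $x_1,x_2$; $X_2=\mathrm{Hom}(F_2,\mathrm{PSL}(3,\mathbb C))\simeq\mathrm{PSL}(3,\mathbb C)^2$, a complex algebraic variety, also with its usual complex topology. Kulkarni limit set of a discrete $G\subset\mathrm{PSL}(3,\mathbb C)$ acting on $\mathbb P^2_{\mathbb C}$: $L_0(G)$ is the closure of the set of points with infinite stabilizer; $L_1(G)$ is the closure of the set of accumulation points of orbits $Gz$, $z\notin L_0(G)$; $L_2(G)$ is the closure of the set of accumulation points of the families $\{g(K)\}_{g\in G}$ with $K$ compact in $\mathbb P^2_{\mathbb C}\setminus(L_0(G)\cup L_1(G))$. $\Lambda_{\mathrm{Kul}}(G)=L_0\cup L_1\cup L_2$, $\Omega_{\mathrm{Kul}}(G)=\mathbb P^2_{\mathbb C}\setminus\Lambda_{\mathrm{Kul}}(G)$. A complex Kleinian group is a discrete subgroup with $\Omega_{\mathrm{Kul}}(G)\neq\varnothing$. $\mathcal K_2\subset X_2$ is the set of representations whose image is a non-virtually-cyclic complex Kleinian group. $\mathcal U_2\subset X_2$ is the Schottky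 locus: a fixed nonempty subset of $X_2$, open in the usual complex topology, such that every $\rho\in\mathcal U_2$ is injective and $\rho(F_2)$ is a discrete, strongly irreducible, $\theta$-divergent complex Kleinian group, of Schottky type (the elements $\rho(x_i)^{\pm1}$ are proximal and play ping–pong on $\mathbb P^2_{\mathbb C}$), with $\nu(\rho(F_2))=\infty$. In particular $\mathcal U_2\subset\mathcal K_2$. Here: strongly irreducible means that no finite-index subgroup preserves a point or a projective line of $\mathbb P^2_{\mathbb C}$; $\theta$-divergent means that for every sequence of pairwise distinct elements both gaps $\lambda_1-\lambda_2$ and $\lambda_2-\lambda_3$ of the logarithms $\lambda_1\ge\lambda_2\ge\lambda_3$ of the singular values (of $\mathrm{SL}(3,\mathbb C)$ lifts) tend to $+\infty$; $\nu(G)$ is the supremum of cardinalities of families of projective lines contained in $\Lambda_{\mathrm{Kul}}(G)$ with no three concurrent. *)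

theory Defs
  imports
    "HOL-Analysis.Analysis"
    "HOL-Algebra.Elementary_Groups"
    "HOL-Computational_Algebra.Polynomial"
    "HOL-Library.Extended_Nat"
begin

section \<open>Group-theoretic notions\<close>

text \<open>Subgroups \<open>S\<close> of a group \<open>G\<close> are regarded as groups \<open>G\<lparr>carrier := S\<rparr>\<close>.\<close>

definition finite_index_subgroup :: "'a set \<Rightarrow> ('a, 'b) monoid_scheme \<Rightarrow> bool" where
  "finite_index_subgroup H G \<longleftrightarrow> subgroup H G \<and> finite (rcosets\<^bsub>G\<^esub> H)"

text \<open>Finite groups are virtually cyclic: the trivial group counts as cyclic.\<close>

definition virtually_cyclic :: "('a, 'b) monoid_scheme \<Rightarrow> bool" where
  "virtually_cyclic G \<longleftrightarrow>
     (\<exists>H. finite_index_subgroup H G \<and> cyclic_group (G\<lparr>carrier := H\<rparr>))"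

primrec lower_central :: "('a, 'b) monoid_scheme \<Rightarrow> nat \<Rightarrow> 'a set" where
  "lower_central G 0 = carrier G"
| "lower_central G (Suc n) =
     generate G {x \<otimes>\<^bsub>G\<^esub> y \<otimes>\<^bsub>G\<^esub> inv\<^bsub>G\<^esub> x \<otimes>\<^bsub>G\<^esub> inv\<^bsub>G\<^esub> y | x y.
       x \<in> lower_central G n \<and> y \<in> carrier G}"

definition nilpotent_group :: "('a, 'b) monoid_scheme \<Rightarrow> bool" where
  "nilpotent_group G \<longleftrightarrow> group G \<and> (\<exists>n. lower_central G n = {\<one>\<^bsub>G\<^esub>})"


section \<open>The free group on two generators\<close>

datatype gen = X1 | X2

text \<open>The letter \<open>(x, True)\<close> is the generator \<open>x\<close>, and \<open>(x, False)\<close> is its inverse.\<close>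

type_synonym letter = "gen \<times> bool"

definition linv :: "letter \<Rightarrow> letter" where
  "linv a = (fst a, \<not> snd a)"

definition reduced_word :: "letter list \<Rightarrow> bool" where
  "reduced_word w \<longleftrightarrow> successively (\<lambda>a b. b \<noteq> linv a) w"

fun lcons :: "letter \<Rightarrow> letter list \<Rightarrow> letter list" where
  "lcons a [] = [a]"
| "lcons a (b # w) = (if b = linv a then w else a # b # w)"

text \<open>The product of two reduced words is their concatenation, freely reduced.\<close>

definition F2 :: "letter list monoid" where
  "F2 = \<lparr>carrier = {w. reduced_word w}, mult = foldr lcons, one = []\<rparr>"

lemma linv_linv [simp]: "linv (linv a) = a"
  by (simp add: linv_def)

lemma linv_neq [simp]: "linv a \<noteq> a"
  by (cases a) (simp add: linv_def)

lemma reduced_Nil [simp]: "reduced_word []"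
  by (simp add: reduced_word_def)

lemma reduced_ConsD: "reduced_word (a # w) \<Longrightarrow> reduced_word w"
  by (cases w) (simp_all add: reduced_word_def)

lemma reduced_lcons: "reduced_word w \<Longrightarrow> reduced_word (lcons a w)"
  by (cases w) (auto simp: reduced_word_def dest: reduced_ConsD[unfolded reduced_word_def])

lemma lcons_reduced: "reduced_word (a # w) \<Longrightarrow> lcons a w = a # w"
  by (cases w) (auto simp: reduced_word_def)

lemma lcons_linv_cancel: "reduced_word w \<Longrightarrow> lcons a (lcons (linv a) w) = w"
  by (cases w) (auto simp: reduced_word_def lcons_reduced)

lemma reduced_foldr_lcons: "reduced_word w \<Longrightarrow> reduced_word (foldr lcons u w)"
  by (induction u) (auto intro: reduced_lcons)

lemma foldr_lcons_lcons:
  assumes "reduced_word w"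
  shows "foldr lcons (lcons a u) w = lcons a (foldr lcons u w)"
proof (cases u)
  case (Cons b v)
  then show ?thesis
    using lcons_linv_cancel[OF reduced_foldr_lcons[OF assms], of a v] by auto
qed simp

lemma foldr_lcons_assoc:
  "reduced_word w \<Longrightarrow> foldr lcons (foldr lcons u v) w = foldr lcons u (foldr lcons v w)"
  by (induction u) (auto simp: foldr_lcons_lcons)

lemma foldr_lcons_Nil: "reduced_word u \<Longrightarrow> foldr lcons u [] = u"
  proof (induction u)
  case (Cons a u)
  then show ?case using reduced_ConsD[of a u] lcons_reduced[of a u] by simp
qed simp

lemma foldr_lcons_inverse: "reduced_word u \<Longrightarrow> \<exists>v. reduced_word v \<and> foldr lcons v u = []"
proof (induction u)
  case (Cons a u)
  then obtain v where v: "reduced_word v" "foldr lcons v u = []"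
    using reduced_ConsD by blast
  have "foldr lcons (foldr lcons v [linv a]) (a # u) = foldr lcons v (lcons (linv a) (a # u))"
    using foldr_lcons_assoc[OF Cons.prems, of v "[linv a]"] by simp
  also have "\<dots> = []"
    using v by simp
  finally show ?case
    using reduced_foldr_lcons[of "[linv a]" v] by (auto simp: reduced_word_def)
next
  case Nil
  show ?case by (rule exI[of _ "[]"]) simp
qed

lemma group_F2: "group F2"
  by (rule groupI)
     (auto simp: F2_def reduced_foldr_lcons foldr_lcons_assoc intro: foldr_lcons_inverse)


section \<open>The group \<open>PSL(3,\<complex>)\<close>\<close>

definition SL3 :: "(complex^3^3) monoid" where
  "SL3 = \<lparr>carrier = {A. det A = 1}, mult = (**), one = mat 1\<rparr>"

definition mu3 :: "(complex^3^3) set" where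
  "mu3 = {mat c | c. c ^ 3 = 1}"

text \<open>An element of \<open>PSL3\<close> is the set of its three lifts to \<open>SL(3,\<complex>)\<close>.\<close>

definition PSL3 :: "(complex^3^3) set monoid" where
  "PSL3 = SL3 Mod mu3"

lemma group_SL3: "group SL3"
proof (rule groupI)
  fix A assume "A \<in> carrier SL3"
  then have A: "det A = 1" by (simp add: SL3_def)
  then obtain B where B: "A ** B = mat 1" "B ** A = mat 1"
    using invertible_det_nz[of A] by (auto simp: invertible_def)
  then have "det B = 1"
    using A det_mul[of A B] by simp
  with B show "\<exists>B\<in>carrier SL3. B \<otimes>\<^bsub>SL3\<^esub> A = \<one>\<^bsub>SL3\<^esub>"
    by (auto simp: SL3_def)
qed (auto simp: SL3_def det_mul matrix_mul_assoc)

lemma det_mat_3: "det (mat c :: complex^3^3) = c ^ 3"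
  by (simp add: det_3 mat_def power3_eq_cube)

lemma mat_mult_left: "mat c ** A = (\<chi> i j. c * A $ i $ j)" for A :: "complex^3^3"
  by (simp add: matrix_matrix_mult_def mat_def vec_eq_iff if_distrib[of "\<lambda>x. x * _"] cong: if_cong)

lemma mat_mult_right: "A ** mat c = (\<chi> i j. c * A $ i $ j)" for A :: "complex^3^3"
  by (simp add: matrix_matrix_mult_def mat_def vec_eq_iff if_distrib[of "\<lambda>x. _ * x"] mult.commute cong: if_cong)

lemma mat_mult_commute: "mat c ** A = A ** mat c" for A :: "complex^3^3"
  by (simp add: mat_mult_left mat_mult_right)

lemma mat_mult_mat: "mat c ** mat d = (mat (c * d) :: complex^3^3)"
  unfolding mat_mult_left by (simp add: mat_def vec_eq_iff)

lemma normal_mu3: "mu3 \<lhd> SL3"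
proof -
  interpret group SL3 by (rule group_SL3)
  have inv_in: "inv\<^bsub>SL3\<^esub> A \<in> mu3" if A: "A \<in> mu3" for A
  proof -
    obtain c where c: "A = mat c" "c ^ 3 = 1" using A by (auto simp: mu3_def)
    then have "c \<noteq> 0" by auto
    with c have "inv\<^bsub>SL3\<^esub> A = mat (inverse c)"
      by (intro inv_equality) (auto simp: SL3_def mat_mult_mat det_mat_3 power_inverse)
    with c show ?thesis by (auto simp: mu3_def power_inverse)
  qed
  have "subgroup mu3 SL3"
  proof (rule subgroupI)
    show "mu3 \<subseteq> carrier SL3" by (auto simp: mu3_def SL3_def det_mat_3)
    show "mu3 \<noteq> {}" by (auto simp: mu3_def intro!: exI[of _ 1])
    show "A \<otimes>\<^bsub>SL3\<^esub> B \<in> mu3" if "A \<in> mu3" "B \<in> mu3" for A B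
    proof -
      from that obtain c d where "A = mat c" "c ^ 3 = 1" "B = mat d" "d ^ 3 = 1"
        by (auto simp: mu3_def)
      then show ?thesis
        by (auto simp: mu3_def SL3_def mat_mult_mat power_mult_distrib intro!: exI[of _ "c * d"])
    qed
  qed (fact inv_in)
  moreover have "mu3 #>\<^bsub>SL3\<^esub> A = A <#\<^bsub>SL3\<^esub> mu3" for A
    by (auto simp: r_coset_def l_coset_def mu3_def SL3_def mat_mult_commute)
  ultimately show ?thesis by (simp add: normal_def normal_axioms_def is_group)
qed

lemma group_PSL3: "group PSL3"
  unfolding PSL3_def by (rule normal.factorgroup_is_group[OF normal_mu3])

text \<open>For a partition \<open>C\<close> of the space \<open>X\<close>, the quotient topology on the set \<open>C\<close> of classes:
  the preimage of \<open>U \<subseteq> C\<close> under the projection is \<open>\<Union>U\<close>.\<close>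

definition partition_topology :: "'a topology \<Rightarrow> 'a set set \<Rightarrow> 'a set topology" where
  "partition_topology X C = topology (\<lambda>U. U \<subseteq> C \<and> openin X (\<Union>U))"

lemma openin_partition_topology:
  assumes "disjoint C"
  shows "openin (partition_topology X C) U \<longleftrightarrow> U \<subseteq> C \<and> openin X (\<Union>U)"
proof -
  have "istopology (\<lambda>U. U \<subseteq> C \<and> openin X (\<Union>U))"
  proof (unfold istopology_def, intro conjI allI impI)
    fix S T assume S: "S \<subseteq> C \<and> openin X (\<Union>S)" and T: "T \<subseteq> C \<and> openin X (\<Union>T)"
    then show "S \<inter> T \<subseteq> C" by blast
    have "a = b" if "a \<in> S" "b \<in> T" "x \<in> a" "x \<in> b" for a b x
      using that S T assms unfolding disjoint_def by blast
    then have "\<Union>(S \<inter> T) = \<Union>S \<inter> \<Union>T" by fast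
    with S T show "openin X (\<Union>(S \<inter> T))" by (simp add: openin_Int)
  next
    fix K assume K: "\<forall>U\<in>K. U \<subseteq> C \<and> openin X (\<Union>U)"
    then show "\<Union>K \<subseteq> C" by blast
    have "openin X (\<Union>(Union ` K))"
      using K by (intro openin_Union) blast
    also have "\<Union>(Union ` K) = \<Union>(\<Union>K)" by blast
    finally show "openin X (\<Union>(\<Union>K))" .
  qed
  then show ?thesis
    unfolding partition_topology_def by simp
qed

definition PSL3_top :: "(complex^3^3) set topology" where
  "PSL3_top = partition_topology (top_of_set (carrier SL3)) (carrier PSL3)"

lemma openin_PSL3_top:
  "openin PSL3_top U \<longleftrightarrow> U \<subseteq> carrier PSL3 \<and> openin (top_of_set (carrier SL3)) (\<Union>U)"
proof -
  have "disjoint (carrier PSL3)"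
    unfolding PSL3_def FactGroup_def pairwise_def disjnt_def
    using group.rcos_disjoint[OF group_SL3 normal_imp_subgroup[OF normal_mu3]]
    by (auto simp: pairwise_def disjnt_def)
  then show ?thesis
    unfolding PSL3_top_def by (rule openin_partition_topology)
qed

definition discrete_subgroup :: "(complex^3^3) set set \<Rightarrow> bool" where
  "discrete_subgroup G \<longleftrightarrow> subgroup G PSL3 \<and> subtopology PSL3_top G = discrete_topology G"


section \<open>The projective plane\<close>

definition proj_pt :: "complex^3 \<Rightarrow> (complex^3) set" where
  "proj_pt v = {c *s v | c. c \<noteq> 0}"

definition P2 :: "(complex^3) set set" where
  "P2 = proj_pt ` (UNIV - {0})"

definition P2_top :: "(complex^3) set topology" where
  "P2_top = partition_topology (top_of_set (UNIV - {0})) P2"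

lemma openin_P2_top:
  "openin P2_top U \<longleftrightarrow> U \<subseteq> P2 \<and> openin (top_of_set (UNIV - {0})) (\<Union>U)"
proof -
  have sub: "proj_pt v \<subseteq> proj_pt w" if "u \<in> proj_pt v" "u \<in> proj_pt w" for u v w
  proof -
    obtain a b where ab: "a \<noteq> 0" "b \<noteq> 0" "a *s v = b *s w"
      using \<open>u \<in> proj_pt v\<close> \<open>u \<in> proj_pt w\<close> by (auto simp: proj_pt_def)
    then have "v = (inverse a * b) *s w"
      by (metis left_inverse vector_smult_assoc vector_smult_lid)
    moreover have "c * (inverse a * b) \<noteq> 0" if "c \<noteq> 0" for c
      using ab that by simp
    ultimately show ?thesis
      unfolding proj_pt_def by (smt (verit) Collect_mono vector_smult_assoc)
  qed
  have "disjoint P2"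
    unfolding P2_def pairwise_def disjnt_def using sub by blast
  then show ?thesis
    unfolding P2_top_def by (rule openin_partition_topology)
qed

definition proj_line :: "(complex^3) set set \<Rightarrow> bool" where
  "proj_line l \<longleftrightarrow> (\<exists>W. vec.subspace W \<and> vec.dim W = 2 \<and> l = {p \<in> P2. p \<subseteq> W})"

definition act :: "(complex^3^3) set \<Rightarrow> (complex^3) set \<Rightarrow> (complex^3) set" where
  "act g p = {A *v v | A v. A \<in> g \<and> v \<in> p}"

lemma act_proj: "act (mu3 #>\<^bsub>SL3\<^esub> A) (proj_pt v) = proj_pt (A *v v)"
proof -
  have *: "(mat d ** A) *v (c *s v) = (d * c) *s (A *v v)" for c d
    by (simp add: mat_mult_left vec_eq_iff matrix_vector_mult_def sum_distrib_left mult_ac)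
  show ?thesis
  proof (intro equalityI subsetI)
    fix w assume "w \<in> act (mu3 #>\<^bsub>SL3\<^esub> A) (proj_pt v)"
    then obtain d c where d: "d ^ 3 = 1" "c \<noteq> 0" and w: "w = (mat d ** A) *v (c *s v)"
      unfolding act_def r_coset_def mu3_def SL3_def proj_pt_def by fastforce
    then have "d * c \<noteq> 0" by auto
    then show "w \<in> proj_pt (A *v v)" unfolding w * proj_pt_def by blast
  next
    fix w assume "w \<in> proj_pt (A *v v)"
    then obtain c where "c \<noteq> 0" "w = (mat 1 ** A) *v (c *s v)"
      unfolding * by (auto simp: proj_pt_def)
    moreover have "mat 1 \<in> mu3"
      by (auto simp: mu3_def intro!: exI[of _ 1])
    then have "mat 1 ** A \<in> mu3 #>\<^bsub>SL3\<^esub> A"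
      unfolding r_coset_def SL3_def by (simp del: matrix_mul_lid) blast
    ultimately show "w \<in> act (mu3 #>\<^bsub>SL3\<^esub> A) (proj_pt v)"
      unfolding act_def proj_pt_def by blast
  qed
qed


section \<open>The Kulkarni limit set\<close>

definition Kul_L0 :: "(complex^3^3) set set \<Rightarrow> (complex^3) set set" where
  "Kul_L0 G = P2_top closure_of {p \<in> P2. infinite {g \<in> G. act g p = p}}"

definition Kul_L1 :: "(complex^3^3) set set \<Rightarrow> (complex^3) set set" where
  "Kul_L1 G = P2_top closure_of
     (\<Union>z \<in> P2 - Kul_L0 G. P2_top derived_set_of ((\<lambda>g. act g z) ` G))"

text \<open>Accumulation points of the family \<open>g(K)\<close>, indexed by \<open>g \<in> G\<close>.\<close>

definition family_accumulation ::
    "(complex^3^3) set set \<Rightarrow> (complex^3) set set \<Rightarrow> (complex^3) set set" where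
  "family_accumulation G K =
     {q \<in> P2. \<forall>U. openin P2_top U \<and> q \<in> U \<longrightarrow> infinite {g \<in> G. act g ` K \<inter> U \<noteq> {}}}"

definition Kul_L2 :: "(complex^3^3) set set \<Rightarrow> (complex^3) set set" where
  "Kul_L2 G = P2_top closure_of
     (\<Union>K \<in> {K. compactin P2_top K \<and> K \<subseteq> P2 - (Kul_L0 G \<union> Kul_L1 G)}. family_accumulation G K)"

definition Kul_limit :: "(complex^3^3) set set \<Rightarrow> (complex^3) set set" where
  "Kul_limit G = Kul_L0 G \<union> Kul_L1 G \<union> Kul_L2 G"

definition Kul_Omega :: "(complex^3^3) set set \<Rightarrow> (complex^3) set set" where
  "Kul_Omega G = P2 - Kul_limit G"

definition complex_Kleinian :: "(complex^3^3) set set \<Rightarrow> bool" where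
  "complex_Kleinian G \<longleftrightarrow> discrete_subgroup G \<and> Kul_Omega G \<noteq> {}"

text \<open>The supremum \<open>\<nu>(G)\<close> of the cardinalities of families of lines in general position
  contained in the limit set.\<close>

definition no_three_concurrent :: "(complex^3) set set set \<Rightarrow> bool" where
  "no_three_concurrent \<F> \<longleftrightarrow>
     (\<forall>a\<in>\<F>. \<forall>b\<in>\<F>. \<forall>c\<in>\<F>. a \<noteq> b \<and> b \<noteq> c \<and> a \<noteq> c \<longrightarrow> a \<inter> b \<inter> c = {})"

definition Kul_nu :: "(complex^3^3) set set \<Rightarrow> enat" where
  "Kul_nu G =
     (SUP \<F> \<in> {\<F>. (\<forall>l\<in>\<F>. proj_line l \<and> l \<subseteq> Kul_limit G) \<and> no_three_concurrent \<F>}.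
        if finite \<F> then enat (card \<F>) else \<infinity>)"


section \<open>Strong irreducibility, proximality, divergence\<close>

definition strongly_irreducible :: "(complex^3^3) set set \<Rightarrow> bool" where
  "strongly_irreducible G \<longleftrightarrow>
     (\<forall>H. finite_index_subgroup H (PSL3\<lparr>carrier := G\<rparr>) \<longrightarrow>
        \<not> (\<exists>p\<in>P2. \<forall>h\<in>H. act h p = p) \<and>
        \<not> (\<exists>l. proj_line l \<and> (\<forall>h\<in>H. act h ` l = l)))"

definition char_poly3 :: "complex^3^3 \<Rightarrow> complex poly" where
  "char_poly3 A = det (mat [:0, 1:] - map_matrix (\<lambda>a. [:a:]) A)"

text \<open>Some (equivalently, every) lift has an eigenvalue of algebraic multiplicity one whose
  modulus is strictly larger than that of every other eigenvalue.\<close>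

definition proximal :: "(complex^3^3) set \<Rightarrow> bool" where
  "proximal g \<longleftrightarrow> (\<exists>A\<in>g. \<exists>z. Polynomial.order z (char_poly3 A) = 1 \<and>
     (\<forall>w. poly (char_poly3 A) w = 0 \<and> w \<noteq> z \<longrightarrow> cmod w < cmod z))"

definition conj_transpose :: "complex^3^3 \<Rightarrow> complex^3^3" where
  "conj_transpose A = (\<chi> i j. cnj (A $ j $ i))"

text \<open>Singular values with multiplicity, in decreasing order: the square roots of the
  eigenvalues (which are real and nonnegative) of \<open>A\<^sup>*A\<close>.\<close>

definition sing_vals :: "complex^3^3 \<Rightarrow> real list" where
  "sing_vals A = rev (sorted_list_of_multiset
     (image_mset (\<lambda>z. sqrt (Re z)) (proots (char_poly3 (conj_transpose A ** A)))))"

text \<open>\<open>log_sing A 0\<close>, \<open>log_sing A 1\<close>, \<open>log_sing A 2\<close> are \<open>\<lambda>\<^sub>1 \<ge> \<lambda>\<^sub>2 \<ge> \<lambda>\<^sub>3\<close>. They are the same for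
  the three lifts of an element of \<open>PSL3\<close>.\<close>

definition log_sing :: "complex^3^3 \<Rightarrow> nat \<Rightarrow> real" where
  "log_sing A i = ln (sing_vals A ! i)"

definition theta_divergent :: "(complex^3^3) set set \<Rightarrow> bool" where
  "theta_divergent G \<longleftrightarrow>
     (\<forall>g A. range g \<subseteq> G \<and> inj g \<and> (\<forall>n::nat. A n \<in> g n) \<longrightarrow>
        filterlim (\<lambda>n. log_sing (A n) 0 - log_sing (A n) 1) at_top sequentially \<and>
        filterlim (\<lambda>n. log_sing (A n) 1 - log_sing (A n) 2) at_top sequentially)"


section \<open>The representation variety\<close>

text \<open>Homomorphisms are taken \<open>undefined\<close> outside the carrier, so that equality of functions
  is equality of homomorphisms.\<close>

definition Rep2 :: "(letter list \<Rightarrow> (complex^3^3) set) set" where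
  "Rep2 = hom F2 PSL3 \<inter> extensional (carrier F2)"

definition Rep2_coords ::
    "(letter list \<Rightarrow> (complex^3^3) set) \<Rightarrow> (complex^3^3) set \<times> (complex^3^3) set" where
  "Rep2_coords \<rho> = (\<rho> [(X1, True)], \<rho> [(X2, True)])"

text \<open>The usual topology, transported from \<open>PSL(3,\<complex>)\<^sup>2\<close>.\<close>

definition Rep2_top :: "(letter list \<Rightarrow> (complex^3^3) set) topology" where
  "Rep2_top = pullback_topology Rep2 Rep2_coords (prod_topology PSL3_top PSL3_top)"

definition rep_image :: "(letter list \<Rightarrow> (complex^3^3) set) \<Rightarrow> (complex^3^3) set set" where
  "rep_image \<rho> = \<rho> ` carrier F2"

text \<open>Polynomial functions in the 18 matrix entries.\<close>

inductive poly_fun2 :: "((complex^3^3) \<times> (complex^3^3) \<Rightarrow> complex) \<Rightarrow> bool" where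
  "poly_fun2 (\<lambda>_. c)"
| "poly_fun2 (\<lambda>x. fst x $ i $ j)"
| "poly_fun2 (\<lambda>x. snd x $ i $ j)"
| "poly_fun2 f \<Longrightarrow> poly_fun2 g \<Longrightarrow> poly_fun2 (\<lambda>x. f x + g x)"
| "poly_fun2 f \<Longrightarrow> poly_fun2 g \<Longrightarrow> poly_fun2 (\<lambda>x. f x * g x)"

text \<open>The variety \<open>PSL(3,\<complex>)\<^sup>2\<close> is the quotient of the affine variety \<open>SL(3,\<complex>)\<^sup>2\<close> by the finite
  group \<open>\<mu>\<^sub>3\<^sup>2\<close>: a subset is Zariski closed iff its set of lifts is Zariski closed in \<open>SL(3,\<complex>)\<^sup>2\<close>.
  As \<open>\<rho>(x\<^sub>1) \<times> \<rho>(x\<^sub>2)\<close> is the set of lifts of \<open>\<rho>\<close>, the set of lifts of \<open>Z\<close> is the union below.\<close>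

definition Rep2_lifts ::
    "(letter list \<Rightarrow> (complex^3^3) set) set \<Rightarrow> ((complex^3^3) \<times> (complex^3^3)) set" where
  "Rep2_lifts Z = (\<Union>\<rho>\<in>Z. fst (Rep2_coords \<rho>) \<times> snd (Rep2_coords \<rho>))"

definition Rep2_zariski_closed :: "(letter list \<Rightarrow> (complex^3^3) set) set \<Rightarrow> bool" where
  "Rep2_zariski_closed Z \<longleftrightarrow> Z \<subseteq> Rep2 \<and>
     (\<exists>P. (\<forall>f\<in>P. poly_fun2 f) \<and>
        Rep2_lifts Z = {x \<in> carrier SL3 \<times> carrier SL3. \<forall>f\<in>P. f x = 0})"

definition Rep2_zariski_dense :: "(letter list \<Rightarrow> (complex^3^3) set) set \<Rightarrow> bool" where
  "Rep2_zariski_dense S \<longleftrightarrow> S \<subseteq> Rep2 \<and>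
     (\<forall>Z. Rep2_zariski_closed Z \<and> S \<subseteq> Z \<longrightarrow> Z = Rep2)"

definition Kleinian_reps :: "(letter list \<Rightarrow> (complex^3^3) set) set" where
  "Kleinian_reps = {\<rho> \<in> Rep2. complex_Kleinian (rep_image \<rho>) \<and>
     \<not> virtually_cyclic (PSL3\<lparr>carrier := rep_image \<rho>\<rparr>)}"

text \<open>Schottky type: the images of the four letters are proximal and play ping-pong on the
  plane. Since the domains are open, the attracting fixed point of \<open>\<rho>(s)\<close> lies in the closure of
  \<open>D s\<close>.\<close>

definition schottky_type :: "(letter list \<Rightarrow> (complex^3^3) set) \<Rightarrow> bool" where
  "schottky_type \<rho> \<longleftrightarrow> (\<forall>s. proximal (\<rho> [s])) \<and>
     (\<exists>D :: letter \<Rightarrow> (complex^3) set set.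
        (\<forall>s. openin P2_top (D s) \<and> D s \<noteq> {}) \<and>
        (\<forall>s t. s \<noteq> t \<longrightarrow> D s \<inter> D t = {}) \<and>
        (\<forall>s t. t \<noteq> linv s \<longrightarrow> act (\<rho> [s]) ` D t \<subseteq> D s))"

text \<open>A Schottky locus is any nonempty open set of representations with the properties below; the
  inclusion in the set of Kleinian representations follows from them.\<close>

definition schottky_locus :: "(letter list \<Rightarrow> (complex^3^3) set) set \<Rightarrow> bool" where
  "schottky_locus U \<longleftrightarrow> U \<noteq> {} \<and> openin Rep2_top U \<and>
     (\<forall>\<rho>\<in>U. inj_on \<rho> (carrier F2) \<and>
        complex_Kleinian (rep_image \<rho>) \<and>
        strongly_irreducible (rep_image \<rho>) \<and>
        theta_divergent (rep_image \<rho>) \<and>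
        schottky_type \<rho> \<and>
        Kul_nu (rep_image \<rho>) = \<infinity>)"

end

theory Submission
  imports Defs
begin

text \<open>
  Commutators of matrices close to the identity are much closer to the identity (Zassenhaus), so a
  discrete group generated by two classes close to the identity has trivial iterated commutators of
  its generators, and is nilpotent. A free group is not nilpotent, so no faithful discrete
  representation is small in this sense. On the other hand the elations
  \<open>[x : y : z] \<mapsto> [x + tz : y : z]\<close>, with \<open>t\<close> in \<open>\<epsilon>\<int>[\<i>]\<close> for a small \<open>\<epsilon>\<close>, form a
  discrete group isomorphic to \<open>\<int>\<^sup>2\<close> with two small generators, whose Kulkarni limit set lies
  in the line \<open>z = 0\<close>.

  Zariski density holds for every nonempty open set. Two matrices \<open>A\<close> and \<open>B\<close> of determinant one are
  joined by the rational path \<open>A + s(B - A)\<close>, its first row divided by the determinant. A polynomial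
  function that vanishes near \<open>A\<close> then vanishes along the whole path.
\<close>

section \<open>Nilpotency from commutators of generators\<close>

text \<open>Contraction controls only commutators with the small generators, whereas
  \<open>lower_central\<close> takes commutators with arbitrary group elements. The upper central
  series bridges the gap: for fixed \<open>x\<close> and normal \<open>N\<close>, the elements whose
  commutator with \<open>x\<close> lies in \<open>N\<close> form a subgroup, so it is enough to test
  generators. How many commutators are needed depends on how well the identity is isolated in the
  group, so no uniform nilpotency class comes out; but the size demanded of the generators, 1/432,
  is the same for all groups, and this makes one neighbourhood serve for all of them. The example
  has to be discrete and not virtually cyclic with generators as small as desired: one complex
  translation parameter has room for a lattice of rank two, which can be scaled freely.\<close>

abbreviation commutator :: "('a, 'b) monoid_scheme \<Rightarrow> 'a \<Rightarrow> 'a \<Rightarrow> 'a" where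
  "commutator G x y \<equiv> x \<otimes>\<^bsub>G\<^esub> y \<otimes>\<^bsub>G\<^esub> inv\<^bsub>G\<^esub> x \<otimes>\<^bsub>G\<^esub> inv\<^bsub>G\<^esub> y"

text \<open>Each term is the preimage of the centre of the quotient of \<open>G\<close> by the
  previous term, written with commutators so that no quotient group has to be formed.\<close>

primrec upper_central :: "('a, 'b) monoid_scheme \<Rightarrow> nat \<Rightarrow> 'a set" where
  "upper_central G 0 = {\<one>\<^bsub>G\<^esub>}"
| "upper_central G (Suc n) =
     {x \<in> carrier G. \<forall>y \<in> carrier G. commutator G x y \<in> upper_central G n}"

context group
begin

text \<open>Together with \<open>m_assoc\<close> and \<open>inv_mult_group\<close> these rules let
  the simplifier reduce words freely, which settles the commutator identities below.\<close>

lemma inv_cancel [simp]: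
  assumes "x \<in> carrier G" "y \<in> carrier G"
  shows "x \<otimes> (inv x \<otimes> y) = y" "inv x \<otimes> (x \<otimes> y) = y"
  using assms by (simp_all flip: m_assoc)

text \<open>This is the preimage of the centralizer of the class of \<open>x\<close> modulo
  \<open>N\<close>. It is what allows a condition on all \<open>y\<close> to be checked on
  generators.\<close>

lemma subgroup_commutator_in_normal:
  assumes N: "N \<lhd> G" and x: "x \<in> carrier G"
  shows "subgroup {y \<in> carrier G. commutator G x y \<in> N} G"
proof -
  interpret N: normal N G by (rule N)
  show ?thesis
  proof (rule subgroupI)
    show "{y \<in> carrier G. commutator G x y \<in> N} \<noteq> {}"
      using x by (auto intro!: exI[of _ \<one>])
  next
    fix y assume "y \<in> {y \<in> carrier G. commutator G x y \<in> N}"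
    then have y: "y \<in> carrier G" and c: "commutator G x y \<in> N" by auto
    have "inv y \<otimes> inv (commutator G x y) \<otimes> y \<in> N"
      using N.inv_op_closed1[of y "inv (commutator G x y)"] y c by simp
    also have "inv y \<otimes> inv (commutator G x y) \<otimes> y = commutator G x (inv y)"
      using x y by (simp add: m_assoc inv_mult_group)
    finally show "inv y \<in> {y \<in> carrier G. commutator G x y \<in> N}" using y by simp
  next
    fix y z assume "y \<in> {y \<in> carrier G. commutator G x y \<in> N}"
      and "z \<in> {y \<in> carrier G. commutator G x y \<in> N}"
    then have y: "y \<in> carrier G" "commutator G x y \<in> N"
      and z: "z \<in> carrier G" "commutator G x z \<in> N" by auto
    have "commutator G x y \<otimes> (y \<otimes> commutator G x z \<otimes> inv y) \<in> N"
      using N.inv_op_closed2[of y "commutator G x z"] y z by simp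
    also have "commutator G x y \<otimes> (y \<otimes> commutator G x z \<otimes> inv y) = commutator G x (y \<otimes> z)"
      using x y(1) z(1) by (simp add: m_assoc inv_mult_group)
    finally show "y \<otimes> z \<in> {y \<in> carrier G. commutator G x y \<in> N}" using y z by simp
  qed auto
qed

text \<open>The commutator of an inverse, a product or a conjugate with \<open>y\<close> is built
  from conjugates of commutators already in the previous term, or of their inverses. Normality of
  that term absorbs the conjugations.\<close>

lemma normal_upper_central: "upper_central G n \<lhd> G"
proof (induction n)
  case 0
  show ?case using one_is_normal by simp
next
  case (Suc n)
  interpret N: normal "upper_central G n" G by (rule Suc)
  show ?case
  proof (subst normal_inv_iff, intro conjI ballI)
    show "subgroup (upper_central G (Suc n)) G"
    proof (rule subgroupI)
      show "upper_central G (Suc n) \<noteq> {}" by (auto intro!: exI[of _ \<one>])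
    next
      fix x assume "x \<in> upper_central G (Suc n)"
      then have x: "x \<in> carrier G" and c: "\<And>y. y \<in> carrier G \<Longrightarrow> commutator G x y \<in> upper_central G n"
        by auto
      have "commutator G (inv x) y \<in> upper_central G n" if y: "y \<in> carrier G" for y
      proof -
        have "inv x \<otimes> inv (commutator G x y) \<otimes> x \<in> upper_central G n"
          using N.inv_op_closed1[of x "inv (commutator G x y)"] x c[OF y] by simp
        also have "inv x \<otimes> inv (commutator G x y) \<otimes> x = commutator G (inv x) y"
          using x y by (simp add: m_assoc inv_mult_group)
        finally show ?thesis .
      qed
      moreover have "inv x \<in> carrier G" using x by simp
      ultimately show "inv x \<in> upper_central G (Suc n)"
        unfolding upper_central.simps by blast
    next
      fix x z assume "x \<in> upper_central G (Suc n)" "z \<in> upper_central G (Suc n)"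
      then have x: "x \<in> carrier G" and cx: "\<And>y. y \<in> carrier G \<Longrightarrow> commutator G x y \<in> upper_central G n"
        and z: "z \<in> carrier G" and cz: "\<And>y. y \<in> carrier G \<Longrightarrow> commutator G z y \<in> upper_central G n"
        by auto
      have "commutator G (x \<otimes> z) y \<in> upper_central G n" if y: "y \<in> carrier G" for y
      proof -
        have "x \<otimes> commutator G z y \<otimes> inv x \<otimes> commutator G x y \<in> upper_central G n"
          using N.inv_op_closed2[of x "commutator G z y"] x cz[OF y] cx[OF y] by simp
        also have "x \<otimes> commutator G z y \<otimes> inv x \<otimes> commutator G x y = commutator G (x \<otimes> z) y"
          using x y z by (simp add: m_assoc inv_mult_group)
        finally show ?thesis .
      qed
      moreover have "x \<otimes> z \<in> carrier G" using x z by simp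
      ultimately show "x \<otimes> z \<in> upper_central G (Suc n)"
        unfolding upper_central.simps by blast
    qed auto
  next
    fix a x assume a: "a \<in> carrier G" and "x \<in> upper_central G (Suc n)"
    then have x: "x \<in> carrier G" and c: "\<And>y. y \<in> carrier G \<Longrightarrow> commutator G x y \<in> upper_central G n"
      by auto
    have "commutator G (a \<otimes> x \<otimes> inv a) y \<in> upper_central G n" if y: "y \<in> carrier G" for y
    proof -
      \<comment> \<open>Moving the conjugation onto \<open>y\<close> brings back \<open>x\<close>
        itself, whose commutators with all of \<open>G\<close> are known.\<close>
      have "a \<otimes> commutator G x (inv a \<otimes> y \<otimes> a) \<otimes> inv a \<in> upper_central G n"
        using N.inv_op_closed2[OF a c[of "inv a \<otimes> y \<otimes> a"]] a y by blast
      also have "a \<otimes> commutator G x (inv a \<otimes> y \<otimes> a) \<otimes> inv a = commutator G (a \<otimes> x \<otimes> inv a) y"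
        using x y a by (simp add: m_assoc inv_mult_group)
      finally show ?thesis .
    qed
    moreover have "a \<otimes> x \<otimes> inv a \<in> carrier G" using a x by simp
    ultimately show "a \<otimes> x \<otimes> inv a \<in> upper_central G (Suc n)"
      unfolding upper_central.simps by blast
  qed
qed

text \<open>The two series run in opposite directions: if the k-th lower term lies in the upper term
  of index n - k, then the commutators generating the next lower term lie one upper term further
  down.\<close>

lemma nilpotent_if_upper_central:
  assumes "upper_central G n = carrier G"
  shows "nilpotent_group G"
proof -
  have "k \<le> n \<Longrightarrow> lower_central G k \<subseteq> upper_central G (n - k)" for k
  proof (induction k)
    case (Suc k)
    interpret N: normal "upper_central G (n - Suc k)" G by (rule normal_upper_central)
    have "n - k = Suc (n - Suc k)" using Suc.prems by simp
    then have "lower_central G k \<subseteq> upper_central G (Suc (n - Suc k))" using Suc by simp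
    then show ?case
      unfolding lower_central.simps
      by (intro generate_subgroup_incl N.subgroup_axioms) auto
  qed (simp add: assms)
  from this[of n] have "lower_central G n \<subseteq> {\<one>}" by simp
  moreover have "\<one> \<in> lower_central G n"
    by (cases n) (auto intro: generate.one)
  ultimately show ?thesis
    unfolding nilpotent_group_def using is_group by blast
qed

text \<open>Going down from \<open>C n\<close>, each \<open>C m\<close> lies in the upper central
  term of index n - m: an \<open>x\<close> in \<open>C m\<close> has its commutators with
  \<open>S\<close> in \<open>C (Suc m)\<close>, and \<open>subgroup_commutator_in_normal\<close>
  extends this from \<open>S\<close> to the whole group.\<close>

lemma nilpotent_if_iterated_commutators_trivial:
  assumes gen: "generate G S = carrier G"
    and C: "S \<subseteq> C 0" "C n \<subseteq> {\<one>}" "\<And>k. C k \<subseteq> carrier G"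
    and comm: "\<And>k x y. x \<in> C k \<Longrightarrow> y \<in> S \<Longrightarrow> commutator G x y \<in> C (Suc k)"
  shows "nilpotent_group G"
proof -
  have "k + m = n \<Longrightarrow> C m \<subseteq> upper_central G k" for k m
  proof (induction k arbitrary: m)
    case (Suc k)
    have IH: "C (Suc m) \<subseteq> upper_central G k" by (rule Suc.IH) (use Suc.prems in simp)
    show ?case
    proof
      fix x assume x: "x \<in> C m"
      then have xG: "x \<in> carrier G" using C(3) by blast
      have "S \<subseteq> carrier G" unfolding gen[symmetric] by (blast intro: generate.incl)
      then have "S \<subseteq> {y \<in> carrier G. commutator G x y \<in> upper_central G k}"
        using comm[OF x] IH by auto
      from generate_subgroup_incl[OF this subgroup_commutator_in_normal[OF normal_upper_central xG]]
      have "carrier G \<subseteq> {y \<in> carrier G. commutator G x y \<in> upper_central G k}"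
        by (simp only: gen)
      with xG show "x \<in> upper_central G (Suc k)"
        unfolding upper_central.simps by blast
    qed
  qed (use C(2) in simp)
  from this[of n 0] C(1) have "S \<subseteq> upper_central G n" by simp
  from generate_subgroup_incl[OF this normal_imp_subgroup[OF normal_upper_central]]
  have "carrier G \<subseteq> upper_central G n" by (simp only: gen)
  moreover have "upper_central G n \<subseteq> carrier G" by (cases n) auto
  ultimately show ?thesis by (intro nilpotent_if_upper_central) blast
qed

end

section \<open>The free group\<close>

lemma one_F2: "\<one>\<^bsub>F2\<^esub> = []" by (simp add: F2_def)

lemma reduced_letter: "reduced_word [a]" by (simp add: reduced_word_def)

lemma letter_in_F2: "[a] \<in> carrier F2" by (simp add: F2_def reduced_letter)

lemma inv_F2_letter: "inv\<^bsub>F2\<^esub> [a] = [linv a]"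
proof -
  have "[linv a] \<otimes>\<^bsub>F2\<^esub> [a] = \<one>\<^bsub>F2\<^esub>" by (simp add: F2_def)
  then show ?thesis using group.inv_equality[OF group_F2] letter_in_F2 by blast
qed

lemma generate_F2: "generate F2 {[(X1, True)], [(X2, True)]} = carrier F2"
proof
  interpret group F2 by (rule group_F2)
  let ?S = "{[(X1, True)], [(X2, True)]}"
  show "generate F2 ?S \<subseteq> carrier F2"
    using letter_in_F2 by (intro generate_incl) auto
  have pos: "[(x, True)] \<in> generate F2 ?S" for x
    by (cases x) (auto intro: generate.incl)
  have letter: "[a] \<in> generate F2 ?S" for a
  proof (cases "snd a")
    case True
    then show ?thesis using pos[of "fst a"] by (metis prod.collapse)
  next
    case False
    then have "[a] = inv\<^bsub>F2\<^esub> [(fst a, True)]"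
      by (cases a) (simp add: inv_F2_letter linv_def)
    then show ?thesis by (cases "fst a") (auto intro: generate.inv)
  qed
  have "w \<in> generate F2 ?S" if "reduced_word w" for w
    using that
  proof (induction w)
    case Nil
    show ?case using generate.one[of F2] by (simp add: one_F2)
  next
    case (Cons a w)
    have "[a] \<otimes>\<^bsub>F2\<^esub> w = a # w"
      by (simp add: F2_def lcons_reduced[OF Cons.prems])
    then show ?case
      using generate.eng[OF letter[of a] Cons.IH[OF reduced_ConsD[OF Cons.prems]]] by simp
  qed
  then show "carrier F2 \<subseteq> generate F2 ?S" by (auto simp: F2_def)
qed

section \<open>Evaluation of words in a group\<close>

definition letter_value :: "('a, 'b) monoid_scheme \<Rightarrow> (gen \<Rightarrow> 'a) \<Rightarrow> letter \<Rightarrow> 'a" where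
  "letter_value G f a = (if snd a then f (fst a) else inv\<^bsub>G\<^esub> f (fst a))"

definition word_value :: "('a, 'b) monoid_scheme \<Rightarrow> (gen \<Rightarrow> 'a) \<Rightarrow> letter list \<Rightarrow> 'a" where
  "word_value G f w = foldr (\<lambda>a x. letter_value G f a \<otimes>\<^bsub>G\<^esub> x) w \<one>\<^bsub>G\<^esub>"

context group
begin

lemma letter_value_closed [simp]:
  "range f \<subseteq> carrier G \<Longrightarrow> letter_value G f a \<in> carrier G"
  by (auto simp: letter_value_def)

lemma word_value_closed [simp]:
  "range f \<subseteq> carrier G \<Longrightarrow> word_value G f w \<in> carrier G"
  by (induction w) (auto simp: word_value_def)

lemma letter_value_linv:
  "range f \<subseteq> carrier G \<Longrightarrow> letter_value G f (linv a) = inv (letter_value G f a)"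
  by (auto simp: letter_value_def linv_def image_subset_iff)

text \<open>Multiplication in \<open>F2\<close> is iterated \<open>lcons\<close>, so cancellation
  happens one letter at a time; this lemma treats it once, and the homomorphism property follows by
  induction on the first factor.\<close>

lemma word_value_lcons:
  assumes f: "range f \<subseteq> carrier G"
  shows "word_value G f (lcons a w) = letter_value G f a \<otimes> word_value G f w"
proof (cases w)
  case (Cons b v)
  show ?thesis
  proof (cases "b = linv a")
    case True
    then show ?thesis
      using word_value_closed[OF f, of v] f
      by (simp add: Cons word_value_def letter_value_linv)
  qed (simp add: Cons word_value_def)
qed (simp add: word_value_def)

lemma word_value_hom:
  assumes f: "range f \<subseteq> carrier G"
  shows "word_value G f \<in> hom F2 G"
proof (rule homI)
  fix u v
  show "word_value G f (u \<otimes>\<^bsub>F2\<^esub> v) = word_value G f u \<otimes> word_value G f v"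
  proof (induction u)
    case (Cons a u)
    then show ?case
      using word_value_lcons[OF f, of a "foldr lcons u v"] f word_value_closed[OF f, of u]
        word_value_closed[OF f, of v] word_value_def[of G f "a # u"] word_value_def[of G f u]
      by (simp add: F2_def m_assoc)
  qed (use word_value_closed[OF f] in \<open>simp add: F2_def word_value_def\<close>)
qed (use f in simp)

end

section \<open>Nontrivial elements deep in the lower central series of the free group\<close>

lemma mult_F2_append: "reduced_word (u @ v) \<Longrightarrow> u \<otimes>\<^bsub>F2\<^esub> v = u @ v"
proof (induction u)
  case (Cons a u)
  then show ?case
    using reduced_ConsD[of a "u @ v"] lcons_reduced[of a "u @ v"] by (simp add: F2_def)
qed (simp add: F2_def)

lemma reduced_append_iff:
  "reduced_word (u @ v) \<longleftrightarrow>
     reduced_word u \<and> reduced_word v \<and> (u = [] \<or> v = [] \<or> hd v \<noteq> linv (last u))"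
  by (auto simp: reduced_word_def successively_append_iff)

lemma reduced_rev_map_linv: "reduced_word (rev (map linv w)) \<longleftrightarrow> reduced_word w"
proof -
  have "successively (\<lambda>a b. linv a \<noteq> b) w = successively (\<lambda>a b. b \<noteq> linv a) w"
    by (rule successively_cong) auto
  then show ?thesis by (simp add: reduced_word_def successively_map)
qed

lemma inv_F2:
  assumes "reduced_word w"
  shows "inv\<^bsub>F2\<^esub> w = rev (map linv w)"
proof -
  have *: "foldr lcons (rev (map linv w)) w = []" for w
    by (induction w) simp_all
  have "rev (map linv w) \<otimes>\<^bsub>F2\<^esub> w = \<one>\<^bsub>F2\<^esub>"
    by (simp add: F2_def *)
  then show ?thesis
    using group.inv_equality[OF group_F2] assms
    by (simp add: F2_def reduced_rev_map_linv)
qed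

text \<open>Commuting with \<open>x\<^sub>1\<close> or \<open>x\<^sub>2\<close>, chosen according to the last letter, produces no
  cancellation.\<close>

lemma lower_central_F2_word:
  "\<exists>w \<in> lower_central F2 n. \<exists>x. reduced_word w \<and> w \<noteq> [] \<and> hd w = (X1, True) \<and> last w = (x, False)"
proof (induction n)
  case 0
  show ?case
    by (rule bexI[of _ "[(X1, True), (X2, True), (X1, False)]"])
       (simp_all add: F2_def reduced_word_def linv_def)
next
  case (Suc n)
  then obtain w x where w: "w \<in> lower_central F2 n" "reduced_word w" "w \<noteq> []"
    "hd w = (X1, True)" "last w = (x, False)" by blast
  \<comment> \<open>\<open>w\<close> ends in the inverse of \<open>x\<close> and its inverse starts
    with \<open>x\<close>, so the other generator \<open>y\<close> cancels on neither side. At the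
    last junction two inverse letters meet, which cannot cancel either. The commutator ends in an
    inverse letter again, as the induction requires.\<close>
  define y where "y = ((if x = X1 then X2 else X1), True)"
  define v where "v = rev (map linv w)"
  have v: "reduced_word v" "v \<noteq> []" "hd v = (x, True)" "last v = (X1, False)"
    using w by (simp_all add: v_def reduced_rev_map_linv hd_rev last_rev hd_map last_map linv_def)
  have r1: "reduced_word (w @ [y])"
    using w reduced_letter by (auto simp: reduced_append_iff y_def linv_def)
  have r2: "reduced_word ((w @ [y]) @ v)"
    using r1 v unfolding reduced_append_iff[of "w @ [y]"] by (auto simp: y_def linv_def)
  have r3: "reduced_word (((w @ [y]) @ v) @ [linv y])"
    using r2 v unfolding reduced_append_iff[of "(w @ [y]) @ v"]
    by (auto simp: y_def linv_def reduced_letter)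
  have "commutator F2 w [y] = ((w @ [y]) @ v) @ [linv y]"
    unfolding inv_F2[OF w(2)] inv_F2_letter v_def[symmetric]
      mult_F2_append[OF r1] mult_F2_append[OF r2] mult_F2_append[OF r3] ..
  moreover have "commutator F2 w [y] \<in> lower_central F2 (Suc n)"
    using w(1) letter_in_F2[of y] unfolding lower_central.simps by (blast intro: generate.incl)
  ultimately have "((w @ [y]) @ v) @ [linv y] \<in> lower_central F2 (Suc n)" by simp
  moreover have "last (((w @ [y]) @ v) @ [linv y]) = (fst y, False)"
    by (simp add: y_def linv_def)
  moreover have "hd (((w @ [y]) @ v) @ [linv y]) = (X1, True)"
    using w by simp
  ultimately show ?case using r3 by blast
qed

text \<open>Homomorphisms respect lower central terms, so if the n-th term of \<open>G\<close> is
  trivial, \<open>h\<close> kills the nonempty word that \<open>lower_central_F2_word\<close>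
  provides.\<close>

lemma nilpotent_imp_F2_hom_not_inj:
  assumes G: "nilpotent_group G" and h: "h \<in> hom F2 G"
  shows "\<not> inj_on h (carrier F2)"
proof
  assume inj: "inj_on h (carrier F2)"
  have grp: "group G" using G by (simp add: nilpotent_group_def)
  interpret group_hom F2 G h
    using grp h group_F2 by (simp add: group_hom_def group_hom_axioms_def)
  have sub: "h ` lower_central F2 n \<subseteq> lower_central G n" for n
  proof (induction n)
    case 0
    show ?case by auto
  next
    case (Suc n)
    have lc: "lower_central F2 m \<subseteq> carrier F2" for m
    proof (induction m)
      case (Suc m)
      then show ?case
        unfolding lower_central.simps by (intro G.generate_incl) (auto simp: subset_iff)
    qed simp
    let ?S = "{commutator F2 x y | x y. x \<in> lower_central F2 n \<and> y \<in> carrier F2}"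
    have "?S \<subseteq> carrier F2" using lc[of n] by (auto simp: subset_iff)
    then have "h ` lower_central F2 (Suc n) = generate G (h ` ?S)"
      using generate_img[of ?S] by simp
    also have "\<dots> \<subseteq> lower_central G (Suc n)"
      unfolding lower_central.simps
    proof (rule H.mono_generate, safe)
      fix x y assume x: "x \<in> lower_central F2 n" and y: "y \<in> carrier F2"
      moreover have "x \<in> carrier F2" using x lc by blast
      ultimately have "h (commutator F2 x y) = commutator G (h x) (h y)" by simp
      moreover have "h x \<in> lower_central G n" "h y \<in> carrier G" using x y Suc by auto
      ultimately show "\<exists>x' y'. h (commutator F2 x y) = commutator G x' y' \<and>
          x' \<in> lower_central G n \<and> y' \<in> carrier G" by blast
    qed
    finally show ?case .
  qed
  obtain n where n: "lower_central G n = {\<one>\<^bsub>G\<^esub>}" using G by (auto simp: nilpotent_group_def)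
  obtain w where w: "w \<in> lower_central F2 n" "reduced_word w" "w \<noteq> []"
    using lower_central_F2_word[of n] by blast
  then have "h w = h []" using sub n hom_one by (auto simp: one_F2)
  then show False
    using inj w unfolding inj_on_def by (auto simp: F2_def)
qed

section \<open>Classes of matrices\<close>

definition psl_class :: "complex^3^3 \<Rightarrow> (complex^3^3) set" where
  "psl_class A = mu3 #>\<^bsub>SL3\<^esub> A"

lemma carrier_SL3 [simp]: "A \<in> carrier SL3 \<longleftrightarrow> det A = 1"
  by (simp add: SL3_def)

lemma mult_SL3 [simp]: "A \<otimes>\<^bsub>SL3\<^esub> B = A ** B" and one_SL3 [simp]: "\<one>\<^bsub>SL3\<^esub> = mat 1"
  by (simp_all add: SL3_def)

lemma mem_psl_class_iff: "B \<in> psl_class A \<longleftrightarrow> (\<exists>c. c ^ 3 = 1 \<and> B = mat c ** A)"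
  by (auto simp: psl_class_def r_coset_def mu3_def)

lemma self_mem_psl_class: "A \<in> psl_class A"
  unfolding mem_psl_class_iff by (rule exI[of _ 1]) simp

lemma carrier_PSL3: "carrier PSL3 = psl_class ` {A. det A = 1}"
  by (auto simp: PSL3_def FactGroup_def RCOSETS_def psl_class_def)

lemma group_hom_psl_class: "group_hom SL3 PSL3 psl_class"
  using normal.r_coset_hom_Mod[OF normal_mu3] group_SL3 group_PSL3
  by (simp add: group_hom_def group_hom_axioms_def psl_class_def[abs_def] PSL3_def)

lemma psl_class_mult: "det A = 1 \<Longrightarrow> det B = 1 \<Longrightarrow> psl_class (A ** B) = psl_class A \<otimes>\<^bsub>PSL3\<^esub> psl_class B"
  using group_hom.hom_mult[OF group_hom_psl_class, of A B] by simp

lemma psl_class_one: "psl_class (mat 1) = \<one>\<^bsub>PSL3\<^esub>"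
  using group_hom.hom_one[OF group_hom_psl_class] by simp

lemma psl_class_inv: "det A = 1 \<Longrightarrow> A ** A' = mat 1 \<Longrightarrow> inv\<^bsub>PSL3\<^esub> psl_class A = psl_class A'"
proof -
  assume A: "det A = 1" "A ** A' = mat 1"
  then have A': "det A' = 1" using det_mul[of A A'] by simp
  have "A' ** A = mat 1" using A matrix_left_right_inverse by blast
  then have "psl_class A' \<otimes>\<^bsub>PSL3\<^esub> psl_class A = \<one>\<^bsub>PSL3\<^esub>" using psl_class_mult[OF A' A(1)] psl_class_one by simp
  then show ?thesis
    using group.inv_equality[OF group_PSL3] A A' by (auto simp: carrier_PSL3)
qed

lemma mem_PSL3D:
  assumes "g \<in> carrier PSL3" "A \<in> g"
  shows "det A = 1" "g = psl_class A"
proof -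
  obtain B where B: "det B = 1" "g = psl_class B" using assms by (auto simp: carrier_PSL3)
  with assms obtain c where c: "c ^ 3 = 1" "A = mat c ** B" by (auto simp: mem_psl_class_iff)
  with B show "det A = 1" by (simp add: det_mul det_mat_3)
  have "A \<in> mu3 #>\<^bsub>SL3\<^esub> B" using assms B by (simp add: psl_class_def)
  then show "g = psl_class A"
    using group.repr_independence[OF group_SL3 _ _ normal_imp_subgroup[OF normal_mu3], of A B] B
    by (simp add: psl_class_def)
qed

text \<open>The projection from \<open>SL3\<close> is open: the saturation of \<open>T\<close> is
  the union of its translates by the cube roots of unity.\<close>

lemma openin_PSL3_top_Collect:
  assumes "open T"
  shows "openin PSL3_top {psl_class A | A. det A = 1 \<and> A \<in> T}"
proof -
  have eq: "\<Union>{psl_class A | A. det A = 1 \<and> A \<in> T} = {B. det B = 1} \<inter> (\<Union>c \<in> {c. c ^ 3 = 1}. (\<lambda>B. mat c ** B) -` T)"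
    (is "?L = ?R")
  proof (intro equalityI subsetI)
    fix B assume "B \<in> ?L"
    then obtain A c where A: "det A = 1" "A \<in> T" "c ^ 3 = 1" "B = mat c ** A"
      by (auto simp: mem_psl_class_iff)
    then have c: "c \<noteq> 0" "inverse c ^ 3 = 1" by (auto simp: power_inverse)
    then have "mat (inverse c) ** B = A"
      using A by (simp add: matrix_mul_assoc mat_mult_mat)
    with A c show "B \<in> ?R" by (auto simp: det_mul det_mat_3)
  next
    fix B assume "B \<in> ?R"
    then obtain c where B: "det B = 1" "c ^ 3 = 1" "mat c ** B \<in> T" by auto
    then have c: "c \<noteq> 0" "inverse c ^ 3 = 1" by (auto simp: power_inverse)
    then have "B = mat (inverse c) ** (mat c ** B)"
      by (simp add: matrix_mul_assoc mat_mult_mat)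
    then have "B \<in> psl_class (mat c ** B)" using c mem_psl_class_iff by blast
    moreover have "det (mat c ** B) = 1" using B by (simp add: det_mul det_mat_3)
    ultimately show "B \<in> ?L" using B by blast
  qed
  have "(\<lambda>B. mat c ** B) = (\<lambda>B :: complex^3^3. \<chi> i j. c * B $ i $ j)" for c
    by (rule ext) (rule mat_mult_left)
  then have "continuous_on UNIV (\<lambda>B :: complex^3^3. mat c ** B)" for c
    by (simp only:) (intro continuous_intros)
  then have "open (\<Union>c \<in> {c. c ^ 3 = 1}. (\<lambda>B. mat c ** B) -` T)"
    using assms by (intro open_UN ballI open_vimage) auto
  then have "openin (top_of_set (carrier SL3)) ?L"
    unfolding eq by (auto simp: openin_open SL3_def)
  then show ?thesis
    unfolding openin_PSL3_top by (auto simp: carrier_PSL3)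
qed

section \<open>Discrete groups generated by small elements\<close>

text \<open>A bound on the largest entry is simpler to handle than an operator norm; the price is a
  factor 3, the number of summands in each entry of a product.\<close>

definition entry_bound :: "real \<Rightarrow> complex^3^3 \<Rightarrow> bool" where
  "entry_bound r A \<longleftrightarrow> (\<forall>i j. cmod (A $ i $ j) \<le> r)"

lemma entry_bound_mult:
  assumes "entry_bound r A" "entry_bound s B"
  shows "entry_bound (3 * r * s) (A ** B)"
proof -
  have "cmod ((A ** B) $ i $ j) \<le> 3 * r * s" for i j
  proof -
    have *: "cmod (A $ i $ k * B $ k $ j) \<le> r * s" for k
      using assms order_trans[OF norm_ge_zero, of "A $ i $ k" r] unfolding entry_bound_def norm_mult
      by (intro mult_mono) auto
    have "cmod ((A ** B) $ i $ j) \<le> (\<Sum>k\<in>UNIV. cmod (A $ i $ k * B $ k $ j))"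
      unfolding matrix_matrix_mult_def by (simp add: norm_sum)
    also have "\<dots> \<le> (\<Sum>k\<in>(UNIV :: 3 set). r * s)"
      using * by (rule sum_mono)
    finally show ?thesis by simp
  qed
  then show ?thesis by (simp add: entry_bound_def)
qed

lemma entry_bound_diff:
  "entry_bound r A \<Longrightarrow> entry_bound s B \<Longrightarrow> entry_bound (r + s) (A - B)"
  unfolding entry_bound_def by (smt (verit) norm_triangle_ineq4 vector_minus_component)

lemma entry_bound_mono: "entry_bound r A \<Longrightarrow> r \<le> s \<Longrightarrow> entry_bound s A"
  unfolding entry_bound_def by (meson order_trans)

text \<open>The least bound exists, so it can be compared with itself in the bootstrap for inverses
  that follows.\<close>

lemma entry_bound_exact:
  obtains r where "0 \<le> r" "entry_bound r A" "\<And>s. entry_bound s A \<Longrightarrow> r \<le> s"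
proof -
  define S where "S = (\<lambda>(i, j). cmod (A $ i $ j)) ` UNIV"
  have S: "finite S" "S \<noteq> {}" by (auto simp: S_def)
  have iff: "entry_bound s A \<longleftrightarrow> Max S \<le> s" for s
    unfolding Max_le_iff[OF S] by (auto simp: entry_bound_def S_def)
  have "\<And>x. x \<in> S \<Longrightarrow> 0 \<le> x" by (auto simp: S_def)
  then have "0 \<le> Max S" using Max_in[OF S] by blast
  then show ?thesis using that[of "Max S"] iff by auto
qed

lemma matrix_add_rdistrib: "(A + B) ** C = A ** C + B ** C" for C :: "complex^3^3"
  by (simp add: matrix_matrix_mult_def vec_eq_iff sum.distrib distrib_right)

lemma matrix_sub_rdistrib: "(A - B) ** C = A ** C - B ** C" for C :: "complex^3^3"
  by (simp add: matrix_matrix_mult_def vec_eq_iff sum_subtractf left_diff_distrib)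

text \<open>From A' = 1 - (A - 1) A' the least bound r of \<open>A'\<close> satisfies r \<le> 1 +
  r/2, hence r \<le> 2. The radius 1/6 is chosen so that 3 * (1/6) = 1/2.\<close>

lemma entry_bound_inverse:
  assumes A: "entry_bound (1 / 6) (A - mat 1)" and inv: "A ** A' = mat 1"
  shows "entry_bound 2 A'"
proof -
  obtain r where r: "0 \<le> r" "entry_bound r A'" "\<And>s. entry_bound s A' \<Longrightarrow> r \<le> s"
    using entry_bound_exact by blast
  have "A' = mat 1 - (A - mat 1) ** A'"
    using inv by (simp add: matrix_sub_rdistrib)
  moreover have "entry_bound 1 (mat 1 :: complex^3^3)"
    by (simp add: entry_bound_def mat_def)
  ultimately have "entry_bound (1 + 3 * (1 / 6) * r) A'"
    using entry_bound_diff entry_bound_mult[OF A r(2)] by metis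
  then have "r \<le> 2" using r(3) by fastforce
  with r show ?thesis using entry_bound_mono by blast
qed

text \<open>With a = A - 1 and b = B - 1 the linear terms drop out of AB - BA = ab - ba, so the
  deviation from the identity is (ab - ba) A' B'. The bounds are 6rs for the first factor and 12 for
  \<open>A' ** B'\<close>, and one more product gives 3 * 6 * 12 = 216.\<close>

lemma commutator_contraction:
  assumes A: "entry_bound r (A - mat 1)" "r \<le> 1 / 6" and B: "entry_bound s (B - mat 1)" "s \<le> 1 / 6"
    and inv: "A ** A' = mat 1" "B ** B' = mat 1"
  shows "entry_bound (216 * r * s) (A ** B ** A' ** B' - mat 1)"
proof -
  define a where "a = A - mat 1"
  define b where "b = B - mat 1"
  have ab: "A = a + mat 1" "B = b + mat 1" by (simp_all add: a_def b_def)
  have "entry_bound 2 A'" "entry_bound 2 B'"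
    using entry_bound_inverse inv A B entry_bound_mono by blast+
  then have *: "entry_bound (3 * 2 * 2) (A' ** B')" by (rule entry_bound_mult)
  have "entry_bound (3 * r * s + 3 * s * r) (a ** b - b ** a)"
    using A B by (intro entry_bound_diff entry_bound_mult) (auto simp: a_def b_def)
  from entry_bound_mult[OF this *]
  have bd: "entry_bound (216 * r * s) ((a ** b - b ** a) ** (A' ** B'))"
    by (simp add: algebra_simps)
  have "a ** b - b ** a = A ** B - B ** A"
    by (simp add: ab matrix_add_ldistrib matrix_add_rdistrib)
  moreover have "B ** A ** (A' ** B') = mat 1"
    using inv by (simp flip: matrix_mul_assoc) (simp add: matrix_mul_assoc)
  ultimately have "(a ** b - b ** a) ** (A' ** B') = A ** B ** A' ** B' - mat 1"
    by (simp add: matrix_sub_rdistrib matrix_mul_assoc)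
  with bd show ?thesis by simp
qed

lemma norm_le_entry_bound:
  fixes A :: "complex^3^3"
  assumes "entry_bound r A"
  shows "norm A \<le> 9 * r"
proof -
  have "norm A \<le> (\<Sum>i\<in>UNIV. norm (A $ i))"
    unfolding norm_vec_def by (rule L2_set_le_sum) simp
  also have "\<dots> \<le> (\<Sum>i\<in>(UNIV :: 3 set). \<Sum>j\<in>(UNIV :: 3 set). cmod (A $ i $ j))"
    by (intro sum_mono, subst norm_vec_def) (rule L2_set_le_sum, simp)
  also have "\<dots> \<le> (\<Sum>i\<in>(UNIV :: 3 set). \<Sum>j\<in>(UNIV :: 3 set). r)"
    using assms by (intro sum_mono) (simp add: entry_bound_def)
  finally show ?thesis by simp
qed

text \<open>This turns discreteness, a property of the quotient topology on classes, into a
  statement about individual lifts.\<close>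

lemma discrete_subgroup_isolated_one:
  assumes "discrete_subgroup G"
  obtains e where "e > 0" "\<And>A. psl_class A \<in> G \<Longrightarrow> entry_bound e (A - mat 1) \<Longrightarrow> psl_class A = \<one>\<^bsub>PSL3\<^esub>"
proof -
  have sub: "subgroup G PSL3" and dis: "subtopology PSL3_top G = discrete_topology G"
    using assms by (auto simp: discrete_subgroup_def)
  have one: "\<one>\<^bsub>PSL3\<^esub> \<in> G" using sub by (rule subgroup.one_closed)
  then have "openin (subtopology PSL3_top G) {\<one>\<^bsub>PSL3\<^esub>}" by (simp add: dis)
  then obtain U where U: "openin PSL3_top U" "{\<one>\<^bsub>PSL3\<^esub>} = U \<inter> G"
    by (auto simp: openin_subtopology)
  then obtain T where T: "open T" "\<Union>U = carrier SL3 \<inter> T"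
    by (auto simp: openin_PSL3_top openin_open)
  have UP: "U \<subseteq> carrier PSL3" using U openin_PSL3_top by blast
  have "psl_class (mat 1) \<in> U" using U psl_class_one by auto
  then have "mat 1 \<in> T" using self_mem_psl_class T by blast
  then obtain e where e: "e > 0" "ball (mat 1) e \<subseteq> T" using T(1) open_contains_ball by blast
  show ?thesis
  proof (rule that)
    \<comment> \<open>\<open>norm_le_entry_bound\<close> loses a factor 9, so entries of size at
      most \<open>e / 10\<close> keep the norm strictly below \<open>e\<close>.\<close>
    show "e / 10 > 0" using e by simp
    fix A assume A: "psl_class A \<in> G" "entry_bound (e / 10) (A - mat 1)"
    then have "norm (A - mat 1) < e" using norm_le_entry_bound[OF A(2)] e by simp
    then have "A \<in> T" using e by (auto simp: dist_norm norm_minus_commute)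
    moreover have AP: "psl_class A \<in> carrier PSL3" using sub A(1) subgroup.subset by blast
    then have "det A = 1" using mem_PSL3D(1) self_mem_psl_class by blast
    ultimately have "A \<in> \<Union>U" using T by simp
    then obtain g where g: "g \<in> U" "A \<in> g" by blast
    then have "psl_class A = g" using UP mem_PSL3D(2) by blast
    then show "psl_class A = \<one>\<^bsub>PSL3\<^esub>" using U A(1) g by blast
  qed
qed

text \<open>Since 432 = 2 * 216, a commutator with a generator lies at most half as far from the
  identity as the element it starts from. After finitely many steps the radius falls below the
  isolation radius of the identity, and only the trivial class remains.\<close>

lemma nilpotent_if_discrete_small_generators:
  assumes disc: "discrete_subgroup G" and gen: "G = generate PSL3 S"
    and small: "\<And>g. g \<in> S \<Longrightarrow> \<exists>A. g = psl_class A \<and> det A = 1 \<and> entry_bound (1 / 432) (A - mat 1)"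
  shows "nilpotent_group (PSL3\<lparr>carrier := G\<rparr>)"
proof -
  interpret P: group PSL3 by (rule group_PSL3)
  have sub: "subgroup G PSL3" using disc by (simp add: discrete_subgroup_def)
  interpret H: group "PSL3\<lparr>carrier := G\<rparr>" using P.subgroup_imp_group[OF sub] .
  have GP: "G \<subseteq> carrier PSL3" using sub by (rule subgroup.subset)
  have SG: "S \<subseteq> G" unfolding gen by (blast intro: generate.incl)
  obtain e where e: "e > 0" "\<And>A. psl_class A \<in> G \<Longrightarrow> entry_bound e (A - mat 1) \<Longrightarrow> psl_class A = \<one>\<^bsub>PSL3\<^esub>"
    using discrete_subgroup_isolated_one[OF disc] by blast
  \<comment> \<open>It is enough that one lift be close to the identity. All radii are at most
    1/432, hence below the 1/6 that \<open>commutator_contraction\<close> asks for.\<close>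
  define C where "C k = {g \<in> G. \<exists>A. g = psl_class A \<and> entry_bound (1 / 432 * (1 / 2) ^ k) (A - mat 1)}" for k
  obtain n where n: "(1 / 2 :: real) ^ n < e" using e real_arch_pow_inv[of e "1/2"] by auto
  show ?thesis
  proof (rule H.nilpotent_if_iterated_commutators_trivial[where S = S and C = C and n = n])
    show "generate (PSL3\<lparr>carrier := G\<rparr>) S = carrier (PSL3\<lparr>carrier := G\<rparr>)"
      using P.generate_consistent[OF SG sub] gen by simp
    show "S \<subseteq> C 0" using small SG by (fastforce simp: C_def)
    have "1 / 432 * (1 / 2) ^ n \<le> e"
      using n zero_le_power[of "1/2::real" n] by linarith
    then show "C n \<subseteq> {\<one>\<^bsub>PSL3\<lparr>carrier := G\<rparr>\<^esub>}"
      using e(2) entry_bound_mono by (fastforce simp: C_def)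
    show "C k \<subseteq> carrier (PSL3\<lparr>carrier := G\<rparr>)" for k by (auto simp: C_def)
  next
    fix k g h assume g: "g \<in> C k" and h: "h \<in> S"
    have gh: "g \<in> G" "h \<in> G" using g h SG by (auto simp: C_def)
    define r :: real where "r = 1 / 432 * (1 / 2) ^ k"
    have r: "0 \<le> r" "r \<le> 1 / 6"
      using power_le_one[of "1/2::real" k] by (auto simp: r_def)
    obtain A where A: "g = psl_class A" "entry_bound r (A - mat 1)" using g by (auto simp: C_def r_def)
    have dA: "det A = 1" using mem_PSL3D(1)[OF _ self_mem_psl_class] gh GP A by blast
    obtain B where B: "h = psl_class B" "det B = 1" "entry_bound (1 / 432) (B - mat 1)"
      using small[OF h] by blast
    obtain A' where A': "A ** A' = mat 1" using dA invertible_det_nz[of A] by (auto simp: invertible_def)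
    obtain B' where B': "B ** B' = mat 1" using B(2) invertible_det_nz[of B] by (auto simp: invertible_def)
    have d': "det A' = 1" "det B' = 1" using A' B' dA B(2) det_mul[of A A'] det_mul[of B B'] by simp_all
    have "commutator (PSL3\<lparr>carrier := G\<rparr>) g h = commutator PSL3 g h"
      using P.m_inv_consistent[OF sub] gh by simp
    also have "\<dots> = psl_class (A ** B ** A' ** B')"
      using A B dA d' psl_class_inv[OF dA A'] psl_class_inv[OF B(2) B'] by (simp add: psl_class_mult det_mul)
    finally have c: "commutator (PSL3\<lparr>carrier := G\<rparr>) g h = psl_class (A ** B ** A' ** B')" .
    have "entry_bound (216 * r * (1 / 432)) (A ** B ** A' ** B' - mat 1)"
      using A B r A' B' by (intro commutator_contraction) auto
    then have "entry_bound (1 / 432 * (1 / 2) ^ Suc k) (A ** B ** A' ** B' - mat 1)"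
      by (simp add: r_def)
    moreover have "commutator (PSL3\<lparr>carrier := G\<rparr>) g h \<in> carrier (PSL3\<lparr>carrier := G\<rparr>)"
      using gh by (intro H.m_closed H.inv_closed) auto
    ultimately show "commutator (PSL3\<lparr>carrier := G\<rparr>) g h \<in> C (Suc k)"
      using c by (auto simp: C_def)
  qed
qed

section \<open>Representations of the free group\<close>

lemma Rep2_group_hom: "\<rho> \<in> Rep2 \<Longrightarrow> group_hom F2 PSL3 \<rho>"
  using group_F2 group_PSL3 by (simp add: Rep2_def group_hom_def group_hom_axioms_def)

lemma Rep2_eqI:
  assumes \<rho>: "\<rho> \<in> Rep2" and \<sigma>: "\<sigma> \<in> Rep2" and eq: "Rep2_coords \<rho> = Rep2_coords \<sigma>"
  shows "\<rho> = \<sigma>"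
proof (rule extensionalityI)
  interpret r: group_hom F2 PSL3 \<rho> using \<rho> by (rule Rep2_group_hom)
  interpret s: group_hom F2 PSL3 \<sigma> using \<sigma> by (rule Rep2_group_hom)
  show "\<rho> \<in> extensional (carrier F2)" "\<sigma> \<in> extensional (carrier F2)"
    using \<rho> \<sigma> by (auto simp: Rep2_def)
  fix w assume "w \<in> carrier F2"
  then have "w \<in> generate F2 {[(X1, True)], [(X2, True)]}" by (simp add: generate_F2)
  then show "\<rho> w = \<sigma> w"
  proof (induction rule: generate.induct)
    case one
    show ?case by simp
  next
    case (incl w)
    then show ?case using eq by (auto simp: Rep2_coords_def)
  next
    case (inv w)
    then have "w \<in> carrier F2" "\<rho> w = \<sigma> w"
      using eq letter_in_F2 by (auto simp: Rep2_coords_def)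
    then show ?case by simp
  next
    case (eng v w)
    then have "v \<in> carrier F2" "w \<in> carrier F2" unfolding generate_F2 by auto
    with eng show ?case by simp
  qed
qed

text \<open>The universal property of the free group; with \<open>Rep2_eqI\<close> it makes
  \<open>Rep2_coords\<close> a bijection onto pairs of classes. The restriction supplies the
  \<open>undefined\<close> values that extensionality demands.\<close>

lemma Rep2_coords_surj:
  assumes "g \<in> carrier PSL3" "h \<in> carrier PSL3"
  obtains \<rho> where "\<rho> \<in> Rep2" "Rep2_coords \<rho> = (g, h)"
proof -
  interpret P: group PSL3 by (rule group_PSL3)
  define f where "f x = (if x = X1 then g else h)" for x
  have f: "range f \<subseteq> carrier PSL3" using assms by (auto simp: f_def)
  define \<rho> where "\<rho> = restrict (word_value PSL3 f) (carrier F2)"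
  have "\<rho> \<in> hom F2 PSL3"
    using P.word_value_hom[OF f] monoid.m_closed[OF group.is_monoid[OF group_F2]]
    by (simp add: \<rho>_def hom_def Pi_def)
  then have "\<rho> \<in> Rep2" by (simp add: Rep2_def \<rho>_def)
  moreover have "Rep2_coords \<rho> = (g, h)"
    using assms by (simp add: Rep2_coords_def \<rho>_def letter_in_F2 word_value_def letter_value_def f_def)
  ultimately show ?thesis by (rule that)
qed

lemma rep_image_generate:
  "\<rho> \<in> Rep2 \<Longrightarrow> rep_image \<rho> = generate PSL3 {fst (Rep2_coords \<rho>), snd (Rep2_coords \<rho>)}"
  using group_hom.generate_img[OF Rep2_group_hom, of \<rho> "{[(X1, True)], [(X2, True)]}"]
  by (simp add: generate_F2 rep_image_def Rep2_coords_def letter_in_F2)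

lemma Rep2_coords_closed:
  "\<rho> \<in> Rep2 \<Longrightarrow> fst (Rep2_coords \<rho>) \<in> carrier PSL3 \<and> snd (Rep2_coords \<rho>) \<in> carrier PSL3"
  using group_hom.hom_closed[OF Rep2_group_hom] letter_in_F2 by (auto simp: Rep2_coords_def)

lemma nilpotent_rep_image_not_inj:
  assumes \<rho>: "\<rho> \<in> Rep2" and nil: "nilpotent_group (PSL3\<lparr>carrier := rep_image \<rho>\<rparr>)"
  shows "\<not> inj_on \<rho> (carrier F2)"
  using nilpotent_imp_F2_hom_not_inj[OF nil, of \<rho>] \<rho>
  by (auto simp: Rep2_def hom_def rep_image_def)

text \<open>The strict inequality makes this set open, and the separate membership
  \<open>A \<in> ...\<close> matches the shape of \<open>openin_PSL3_top_Collect\<close>.\<close>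

definition small_classes :: "(complex^3^3) set set" where
  "small_classes = {psl_class A | A. det A = 1 \<and> A \<in> {A. \<forall>i j. cmod ((A - mat 1) $ i $ j) < 1 / 432}}"

lemma openin_small_classes: "openin PSL3_top small_classes"
  unfolding small_classes_def
proof (rule openin_PSL3_top_Collect)
  have "{A :: complex^3^3. \<forall>i j. cmod ((A - mat 1) $ i $ j) < 1 / 432} =
      (\<Inter>i. \<Inter>j. {A. cmod ((A - mat 1) $ i $ j) < 1 / 432})" by auto
  also have "open \<dots>"
    by (intro open_INT finite ballI open_Collect_less continuous_intros)
  finally show "open {A :: complex^3^3. \<forall>i j. cmod ((A - mat 1) $ i $ j) < 1 / 432}" .
qed

definition small_reps :: "(letter list \<Rightarrow> (complex^3^3) set) set" where
  "small_reps = Rep2_coords -` (small_classes \<times> small_classes) \<inter> Rep2"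

lemma openin_small_reps: "openin Rep2_top small_reps"
  unfolding Rep2_top_def openin_pullback_topology small_reps_def
  by (rule exI[of _ "small_classes \<times> small_classes"])
     (simp add: openin_prod_Times_iff openin_small_classes)

lemma discrete_small_rep_nilpotent:
  assumes \<rho>: "\<rho> \<in> small_reps" and disc: "discrete_subgroup (rep_image \<rho>)"
  shows "nilpotent_group (PSL3\<lparr>carrier := rep_image \<rho>\<rparr>)"
proof (rule nilpotent_if_discrete_small_generators[OF disc rep_image_generate])
  show "\<rho> \<in> Rep2" using \<rho> by (simp add: small_reps_def)
  fix g assume "g \<in> {fst (Rep2_coords \<rho>), snd (Rep2_coords \<rho>)}"
  then have "g \<in> small_classes" using \<rho> by (auto simp: small_reps_def)
  then show "\<exists>A. g = psl_class A \<and> det A = 1 \<and> entry_bound (1 / 432) (A - mat 1)"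
    by (auto simp: small_classes_def entry_bound_def intro: less_imp_le)
qed

section \<open>Zariski density of open sets\<close>

text \<open>Scaling the whole matrix to determinant one would require a cube root; scaling a single
  row keeps the entries rational.\<close>

definition normalize_det :: "complex^3^3 \<Rightarrow> complex^3^3" where
  "normalize_det M = (\<chi> i j. if i = 1 then M $ i $ j / det M else M $ i $ j)"

definition segment_path :: "complex^3^3 \<Rightarrow> complex^3^3 \<Rightarrow> complex \<Rightarrow> complex^3^3" where
  "segment_path A B s = (\<chi> i j. A $ i $ j + s * (B $ i $ j - A $ i $ j))"

lemma det_normalize_det: "det M \<noteq> 0 \<Longrightarrow> det (normalize_det M) = 1"
proof -
  assume M: "det M \<noteq> 0"
  have "det (\<chi> i j. if i = 1 then M $ i $ j / d else M $ i $ j) = det M / d" for d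
    by (simp add: det_3 add_divide_distrib diff_divide_distrib)
  from this[of "det M"] M show ?thesis by (simp add: normalize_det_def)
qed

lemma normalize_det_id: "det M = 1 \<Longrightarrow> normalize_det M = M"
  by (simp add: normalize_det_def vec_eq_iff)

lemma segment_path_0 [simp]: "segment_path A B 0 = A"
  and segment_path_1 [simp]: "segment_path A B 1 = B"
  by (simp_all add: segment_path_def vec_eq_iff)

section \<open>Polynomial and rational functions along a path\<close>

definition is_poly :: "(complex \<Rightarrow> complex) \<Rightarrow> bool" where
  "is_poly h \<longleftrightarrow> (\<exists>p. h = poly p)"

lemma is_poly_const: "is_poly (\<lambda>_. c)"
  unfolding is_poly_def by (rule exI[of _ "[:c:]"]) (simp add: fun_eq_iff)

lemma is_poly_id: "is_poly (\<lambda>s. s)"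
  unfolding is_poly_def by (rule exI[of _ "[:0, 1:]"]) (simp add: fun_eq_iff)

lemma is_poly_add:
  assumes "is_poly f" "is_poly g"
  shows "is_poly (\<lambda>s. f s + g s)"
proof -
  obtain p r where "f = poly p" "g = poly r" using assms by (auto simp: is_poly_def)
  then show ?thesis unfolding is_poly_def by (intro exI[of _ "p + r"]) (simp add: fun_eq_iff)
qed

lemma is_poly_mult:
  assumes "is_poly f" "is_poly g"
  shows "is_poly (\<lambda>s. f s * g s)"
proof -
  obtain p r where "f = poly p" "g = poly r" using assms by (auto simp: is_poly_def)
  then show ?thesis unfolding is_poly_def by (intro exI[of _ "p * r"]) (simp add: fun_eq_iff)
qed

lemma is_poly_diff:
  assumes "is_poly f" "is_poly g"
  shows "is_poly (\<lambda>s. f s - g s)"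
proof -
  obtain p r where "f = poly p" "g = poly r" using assms by (auto simp: is_poly_def)
  then show ?thesis unfolding is_poly_def by (intro exI[of _ "p - r"]) (simp add: fun_eq_iff)
qed

lemma is_poly_power:
  assumes "is_poly f"
  shows "is_poly (\<lambda>s. f s ^ k)"
proof -
  obtain p where "f = poly p" using assms by (auto simp: is_poly_def)
  then show ?thesis unfolding is_poly_def by (intro exI[of _ "p ^ k"]) (simp add: fun_eq_iff)
qed

lemmas is_poly_intros = is_poly_const is_poly_id is_poly_add is_poly_diff is_poly_mult is_poly_power

lemma is_poly_entry: "is_poly (\<lambda>s. segment_path A B s $ i $ j)"
  unfolding segment_path_def by (simp, intro is_poly_intros)

lemma is_poly_det: "is_poly (\<lambda>s. det (segment_path A B s))"
  unfolding det_3 by (intro is_poly_intros is_poly_entry)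

text \<open>The function \<open>h\<close> is a polynomial divided by a power of \<open>q\<close>.
  Zeros of \<open>q\<close> are left out because division by zero yields 0 there and the equation
  may fail.\<close>

definition poly_up_to_power :: "(complex \<Rightarrow> complex) \<Rightarrow> (complex \<Rightarrow> complex) \<Rightarrow> bool" where
  "poly_up_to_power q h \<longleftrightarrow> (\<exists>k p. is_poly p \<and> (\<forall>s. q s \<noteq> 0 \<longrightarrow> h s * q s ^ k = p s))"

lemma poly_up_to_powerI: "is_poly p \<Longrightarrow> (\<And>s. q s \<noteq> 0 \<Longrightarrow> h s * q s ^ k = p s) \<Longrightarrow> poly_up_to_power q h"
  unfolding poly_up_to_power_def by blast

lemma poly_up_to_power_poly: "is_poly h \<Longrightarrow> poly_up_to_power q h"
  by (rule poly_up_to_powerI[of h _ _ 0]) auto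

lemma poly_up_to_power_add:
  assumes q: "is_poly q" and "poly_up_to_power q f" "poly_up_to_power q g"
  shows "poly_up_to_power q (\<lambda>s. f s + g s)"
proof -
  obtain k p where p: "is_poly p" "\<And>s. q s \<noteq> 0 \<Longrightarrow> f s * q s ^ k = p s"
    using assms(2) unfolding poly_up_to_power_def by blast
  obtain l r where r: "is_poly r" "\<And>s. q s \<noteq> 0 \<Longrightarrow> g s * q s ^ l = r s"
    using assms(3) unfolding poly_up_to_power_def by blast
  show ?thesis
  proof (rule poly_up_to_powerI)
    show "is_poly (\<lambda>s. p s * q s ^ l + r s * q s ^ k)"
      using p(1) r(1) q by (intro is_poly_intros)
    show "(f s + g s) * q s ^ (k + l) = p s * q s ^ l + r s * q s ^ k" if "q s \<noteq> 0" for s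
      by (simp add: p(2)[OF that, symmetric] r(2)[OF that, symmetric] power_add algebra_simps)
  qed
qed

lemma poly_up_to_power_mult:
  assumes "poly_up_to_power q f" "poly_up_to_power q g"
  shows "poly_up_to_power q (\<lambda>s. f s * g s)"
proof -
  obtain k p where p: "is_poly p" "\<And>s. q s \<noteq> 0 \<Longrightarrow> f s * q s ^ k = p s"
    using assms(1) unfolding poly_up_to_power_def by blast
  obtain l r where r: "is_poly r" "\<And>s. q s \<noteq> 0 \<Longrightarrow> g s * q s ^ l = r s"
    using assms(2) unfolding poly_up_to_power_def by blast
  show ?thesis
  proof (rule poly_up_to_powerI)
    show "is_poly (\<lambda>s. p s * r s)"
      using p(1) r(1) by (intro is_poly_intros)
    show "(f s * g s) * q s ^ (k + l) = p s * r s" if "q s \<noteq> 0" for s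
      by (simp add: p(2)[OF that, symmetric] r(2)[OF that, symmetric] power_add algebra_simps)
  qed
qed

text \<open>The factor \<open>e\<close> will be the determinant along the other path, so that the
  product \<open>q\<close> of both determinants is a common denominator for the entries of both
  matrices.\<close>

lemma poly_up_to_power_entry:
  assumes e: "is_poly e" and q: "\<And>s. q s = det (segment_path A B s) * e s"
  shows "poly_up_to_power q (\<lambda>s. normalize_det (segment_path A B s) $ i $ j)"
proof (cases "i = 1")
  case True
  show ?thesis
  proof (rule poly_up_to_powerI)
    show "is_poly (\<lambda>s. segment_path A B s $ i $ j * e s)"
      using e by (intro is_poly_intros is_poly_entry)
    show "normalize_det (segment_path A B s) $ i $ j * q s ^ 1 = segment_path A B s $ i $ j * e s"
      if "q s \<noteq> 0" for s
      using that True by (simp add: normalize_det_def q)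
  qed
next
  case False
  then have "(\<lambda>s. normalize_det (segment_path A B s) $ i $ j) = (\<lambda>s. segment_path A B s $ i $ j)"
    by (simp add: normalize_det_def)
  then show ?thesis using poly_up_to_power_poly[OF is_poly_entry] by simp
qed

lemma tendsto_normalize_segment:
  assumes "det A = 1"
  shows "((\<lambda>s. normalize_det (segment_path A B s)) \<longlongrightarrow> A) (at 0)"
proof -
  have path: "((\<lambda>s. segment_path A B s $ i $ j) \<longlongrightarrow> A $ i $ j) (at 0)" for i j
  proof -
    have "((\<lambda>s. A $ i $ j + s * (B $ i $ j - A $ i $ j)) \<longlongrightarrow> A $ i $ j + 0 * (B $ i $ j - A $ i $ j)) (at 0)"
      by (intro tendsto_intros)
    then show ?thesis by (simp add: segment_path_def)
  qed
  then have det: "((\<lambda>s. det (segment_path A B s)) \<longlongrightarrow> det A) (at 0)"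
    unfolding det_3 by (intro tendsto_add tendsto_diff tendsto_mult path)
  have "((\<lambda>s. \<chi> i j. if i = 1 then segment_path A B s $ i $ j / det (segment_path A B s)
      else segment_path A B s $ i $ j) \<longlongrightarrow> (\<chi> i j. if i = 1 then A $ i $ j / 1 else A $ i $ j)) (at 0)"
  proof (intro tendsto_vec_lambda)
    fix i j :: 3
    show "((\<lambda>s. if i = 1 then segment_path A B s $ i $ j / det (segment_path A B s)
      else segment_path A B s $ i $ j) \<longlongrightarrow> (if i = 1 then A $ i $ j / 1 else A $ i $ j)) (at 0)"
      using path[of i j] tendsto_divide[OF path[of i j] det] assms by (cases "i = 1") simp_all
  qed
  moreover have "(\<chi> i j. if i = 1 then A $ i $ j / 1 else A $ i $ j) = A" by (simp add: vec_eq_iff)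
  ultimately show ?thesis by (simp add: normalize_det_def)
qed

text \<open>Both determinants may vanish at some parameters, so the path itself cannot be followed
  blindly. Multiplying by a power of \<open>q\<close> gives a polynomial in \<open>s\<close> that is
  zero near 0, hence identically zero, and \<open>q\<close> is 1 again at the endpoint 1.\<close>

lemma poly_fun2_vanishes:
  assumes f: "poly_fun2 f" and T: "open T" "(A0, B0) \<in> T"
    and det: "det A0 = 1" "det B0 = 1" "det A = 1" "det B = 1"
    and van: "\<And>C D. det C = 1 \<Longrightarrow> det D = 1 \<Longrightarrow> (C, D) \<in> T \<Longrightarrow> f (C, D) = 0"
  shows "f (A, B) = 0"
proof -
  define M where "M = segment_path A0 A"
  define N where "N = segment_path B0 B"
  define q where "q s = det (M s) * det (N s)" for s
  define \<gamma> where "\<gamma> s = (normalize_det (M s), normalize_det (N s))" for s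
  have q: "is_poly q"
    unfolding q_def M_def N_def by (intro is_poly_intros is_poly_det)
  have "poly_up_to_power q (\<lambda>s. f (\<gamma> s))"
    using f
  proof (induction rule: poly_fun2.induct)
    case (1 c)
    show ?case by (intro poly_up_to_power_poly is_poly_const)
  next
    case (2 i j)
    show ?case
      unfolding \<gamma>_def fst_conv M_def
      by (rule poly_up_to_power_entry[of "\<lambda>s. det (N s)"]) (simp_all add: q_def M_def N_def is_poly_det)
  next
    case (3 i j)
    show ?case
      unfolding \<gamma>_def snd_conv N_def
      by (rule poly_up_to_power_entry[of "\<lambda>s. det (M s)"]) (simp_all add: q_def M_def N_def is_poly_det)
  next
    case (4 f g)
    then show ?case using poly_up_to_power_add[OF q] by blast
  next
    case (5 f g)
    then show ?case using poly_up_to_power_mult by blast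
  qed
  then obtain k p where p: "\<And>s. q s \<noteq> 0 \<Longrightarrow> f (\<gamma> s) * q s ^ k = poly p s"
    unfolding poly_up_to_power_def is_poly_def by blast
  obtain Q where Q: "q = poly Q" using q by (auto simp: is_poly_def)
  have "q 0 = 1" using det by (simp add: q_def M_def N_def)
  moreover have "isCont q 0" unfolding Q by (rule poly_isCont)
  ultimately have "eventually (\<lambda>s. q s \<noteq> 0) (at 0)"
    using tendsto_imp_eventually_ne[of q 1 "at 0" 0] by (simp add: isCont_def)
  moreover have "(\<gamma> \<longlongrightarrow> (A0, B0)) (at 0)"
    unfolding \<gamma>_def M_def N_def by (intro tendsto_Pair tendsto_normalize_segment det)
  then have "eventually (\<lambda>s. \<gamma> s \<in> T) (at 0)" using T by (rule topological_tendstoD)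
  ultimately have zero: "eventually (\<lambda>s. poly p s = 0) (at 0)"
  proof eventually_elim
    case (elim s)
    then have "f (\<gamma> s) = 0"
      unfolding \<gamma>_def by (intro van) (auto simp: q_def det_normalize_det)
    with p elim show ?case by fastforce
  qed
  have "p = 0"
  proof (rule ccontr)
    assume "p \<noteq> 0"
    then have "\<not> 0 islimpt {s. poly p s = 0}"
      using islimpt_finite poly_roots_finite by blast
    then have "eventually (\<lambda>s. poly p s \<noteq> 0) (at 0)"
      by (simp add: islimpt_iff_eventually)
    with zero have "eventually (\<lambda>s :: complex. False) (at 0)"
      by eventually_elim simp
    then show False by simp
  qed
  moreover have "\<gamma> 1 = (A, B)" "q 1 = 1" using det
    by (simp_all add: \<gamma>_def q_def M_def N_def normalize_det_id)
  ultimately show ?thesis using p[of 1] by simp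
qed

text \<open>The lifts of \<open>U\<close> contain an open box of \<open>SL3\<close> times
  \<open>SL3\<close>, on which every equation of a closed set containing \<open>U\<close> holds;
  \<open>poly_fun2_vanishes\<close> spreads these equations to all pairs of lifts.\<close>

lemma open_imp_zariski_dense:
  assumes U: "openin Rep2_top U" "U \<noteq> {}"
  shows "Rep2_zariski_dense U"
proof -
  obtain \<sigma> where \<sigma>: "\<sigma> \<in> U" using U by blast
  obtain O2 where O2: "openin (prod_topology PSL3_top PSL3_top) O2" "U = Rep2_coords -` O2 \<inter> Rep2"
    using U(1) unfolding Rep2_top_def openin_pullback_topology by blast
  then obtain S T where ST: "openin PSL3_top S" "openin PSL3_top T"
    "fst (Rep2_coords \<sigma>) \<in> S" "snd (Rep2_coords \<sigma>) \<in> T" "S \<times> T \<subseteq> O2"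
    using \<sigma> unfolding openin_prod_topology_alt by (metis IntD1 prod.collapse vimageE)
  obtain S' T' where S'T': "open S'" "\<Union>S = carrier SL3 \<inter> S'" "open T'" "\<Union>T = carrier SL3 \<inter> T'"
    using ST(1,2) by (auto simp: openin_PSL3_top openin_open)
  have sub: "S \<subseteq> carrier PSL3" "T \<subseteq> carrier PSL3" using ST(1,2) by (auto simp: openin_PSL3_top)
  obtain A0 where A0: "det A0 = 1" "fst (Rep2_coords \<sigma>) = psl_class A0"
    using ST sub by (auto simp: carrier_PSL3)
  obtain B0 where B0: "det B0 = 1" "snd (Rep2_coords \<sigma>) = psl_class B0"
    using ST sub by (auto simp: carrier_PSL3)
  have mem: "A0 \<in> S'" "B0 \<in> T'" using ST S'T' A0 B0 self_mem_psl_class by blast+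
  show ?thesis
    unfolding Rep2_zariski_dense_def
  proof (intro conjI allI impI)
    show "U \<subseteq> Rep2" using O2 by blast
    fix Z assume Z: "Rep2_zariski_closed Z \<and> U \<subseteq> Z"
    then obtain P where ZR: "Z \<subseteq> Rep2" and P: "\<forall>f\<in>P. poly_fun2 f"
      "Rep2_lifts Z = {x \<in> carrier SL3 \<times> carrier SL3. \<forall>f\<in>P. f x = 0}"
      unfolding Rep2_zariski_closed_def by blast
    have lift: "(C, D) \<in> Rep2_lifts Z" if "det C = 1" "det D = 1" "(C, D) \<in> S' \<times> T'" for C D
    proof -
      have "C \<in> \<Union>S" "D \<in> \<Union>T" using that S'T' by auto
      then have "psl_class C \<in> S" "psl_class D \<in> T" using sub mem_PSL3D(2) by blast+
      then have g: "psl_class C \<in> carrier PSL3" "psl_class D \<in> carrier PSL3" "(psl_class C, psl_class D) \<in> O2"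
        using sub ST by blast+
      obtain \<rho> where "\<rho> \<in> Rep2" "Rep2_coords \<rho> = (psl_class C, psl_class D)"
        using Rep2_coords_surj g by blast
      then have "\<rho> \<in> Z" "Rep2_coords \<rho> = (psl_class C, psl_class D)" using g O2 Z by auto
      then show ?thesis unfolding Rep2_lifts_def using self_mem_psl_class by force
    qed
    have all: "(A, B) \<in> Rep2_lifts Z" if AB: "det A = 1" "det B = 1" for A B
    proof -
      have "f (A, B) = 0" if "f \<in> P" for f
      proof (rule poly_fun2_vanishes)
        show "poly_fun2 f" using P that by blast
        show "open (S' \<times> T')" using S'T' by (intro open_Times)
        show "(A0, B0) \<in> S' \<times> T'" using mem by simp
        show "f (C, D) = 0" if "det C = 1" "det D = 1" "(C, D) \<in> S' \<times> T'" for C D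
          using lift[OF that] P(2) \<open>f \<in> P\<close> by blast
      qed (fact A0 B0 AB)+
      with P AB show ?thesis by simp
    qed
    show "Z = Rep2"
    proof (intro equalityI subsetI)
      fix \<rho> assume \<rho>: "\<rho> \<in> Rep2"
      obtain A B where A: "det A = 1" "fst (Rep2_coords \<rho>) = psl_class A"
        and B: "det B = 1" "snd (Rep2_coords \<rho>) = psl_class B"
        using Rep2_coords_closed[OF \<rho>] by (auto simp: carrier_PSL3)
      \<comment> \<open>\<open>\<tau>\<close> shares the lifts \<open>A\<close> and \<open>B\<close>
        with \<open>\<rho>\<close>. A lift determines its class, so both representations agree on
        the generators.\<close>
      obtain \<tau> where \<tau>: "\<tau> \<in> Z" "A \<in> fst (Rep2_coords \<tau>)" "B \<in> snd (Rep2_coords \<tau>)"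
        using all[OF A(1) B(1)] by (auto simp: Rep2_lifts_def)
      then have "\<tau> \<in> Rep2" using ZR by blast
      then have "Rep2_coords \<tau> = Rep2_coords \<rho>"
        using Rep2_coords_closed[of \<tau>] \<tau> A B mem_PSL3D(2) by (metis prod.expand)
      then show "\<rho> \<in> Z" using Rep2_eqI[OF \<open>\<tau> \<in> Rep2\<close> \<rho>] \<tau> by simp
    qed (use ZR in blast)
  qed
qed

section \<open>A lattice of elations\<close>

text \<open>The elation with axis z = 0 and centre [1 : 0 : 0]. In the chart z = 1 it is the
  translation of the first coordinate by \<open>t\<close>.\<close>

definition elation_mat :: "complex \<Rightarrow> complex^3^3" where
  "elation_mat t = (\<chi> i j. if i = 1 \<and> j = 3 then t else mat 1 $ i $ j)"

definition elation :: "complex \<Rightarrow> (complex^3^3) set" where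
  "elation t = psl_class (elation_mat t)"

lemma det_elation_mat [simp]: "det (elation_mat t) = 1"
  by (simp add: elation_mat_def det_3 mat_def)

lemma elation_mat_mult: "elation_mat s ** elation_mat t = elation_mat (s + t)"
  by (simp add: elation_mat_def matrix_matrix_mult_def vec_eq_iff forall_3 sum_3 mat_def)

lemma elation_closed [simp]: "elation t \<in> carrier PSL3"
  by (auto simp: elation_def carrier_PSL3)

lemma elation_mult: "elation s \<otimes>\<^bsub>PSL3\<^esub> elation t = elation (s + t)"
  by (simp add: elation_def psl_class_mult[symmetric] elation_mat_mult)

lemma elation_0: "elation 0 = \<one>\<^bsub>PSL3\<^esub>"
proof -
  have "elation_mat 0 = mat 1" by (simp add: elation_mat_def vec_eq_iff mat_def)
  then show ?thesis by (simp add: elation_def psl_class_one)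
qed

lemma elation_inv: "inv\<^bsub>PSL3\<^esub> elation t = elation (- t)"
  using group.inv_equality[OF group_PSL3, of "elation (- t)" "elation t"]
  by (simp add: elation_mult elation_0)

lemma elation_nat_pow: "elation t [^]\<^bsub>PSL3\<^esub> (n :: nat) = elation (of_nat n * t)"
proof (induction n)
  case (Suc n)
  then show ?case
    using monoid.nat_pow_Suc[OF group.is_monoid[OF group_PSL3], of "elation t" n]
    by (simp add: elation_mult algebra_simps)
qed (simp add: elation_0 nat_pow_def)

lemma elation_int_pow: "elation t [^]\<^bsub>PSL3\<^esub> (n :: int) = elation (of_int n * t)"
  by (cases n rule: int_cases2)
     (simp_all add: group.int_pow_neg[OF group_PSL3] int_pow_int elation_nat_pow elation_inv)

text \<open>The disc of radius \<open>r\<close> around \<open>t\<close> in the coordinate \<open>A\<^sub>1\<^sub>3 / A\<^sub>1\<^sub>1\<close>, which is the same for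
  the three lifts.\<close>

definition shear_coord_ball :: "complex \<Rightarrow> real \<Rightarrow> (complex^3^3) set" where
  "shear_coord_ball t r = {A. cmod (A $ 1 $ 3 - t * A $ 1 $ 1) < r * cmod (A $ 1 $ 1)}"

lemma mem_elation_iff: "A \<in> elation t \<longleftrightarrow> (\<exists>c. c ^ 3 = 1 \<and> A = (\<chi> i j. c * elation_mat t $ i $ j))"
  by (simp add: elation_def mem_psl_class_iff mat_mult_left)

lemma elation_shear_coord:
  assumes "A \<in> elation s"
  shows "A \<in> shear_coord_ball t r \<longleftrightarrow> cmod (s - t) < r"
proof -
  obtain c where c: "c ^ 3 = 1" "A = (\<chi> i j. c * elation_mat s $ i $ j)"
    using assms by (auto simp: mem_elation_iff)
  then have "cmod c > 0" by auto
  have "A $ 1 $ 3 - t * A $ 1 $ 1 = c * (s - t)" "A $ 1 $ 1 = c"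
    by (simp_all add: c elation_mat_def mat_def algebra_simps)
  then have "A \<in> shear_coord_ball t r \<longleftrightarrow> cmod c * cmod (s - t) < cmod c * r"
    by (simp add: shear_coord_ball_def norm_mult mult.commute)
  with \<open>cmod c > 0\<close> show ?thesis by simp
qed

lemma elation_inj: "elation s = elation t \<longleftrightarrow> s = t"
proof
  assume eq: "elation s = elation t"
  have mem: "elation_mat s \<in> elation s" by (simp add: elation_def self_mem_psl_class)
  show "s = t"
  proof (rule ccontr)
    assume "s \<noteq> t"
    \<comment> \<open>The open ball around \<open>t\<close> of radius |s - t| contains
      \<open>t\<close> and just misses \<open>s\<close>, so it tells the two classes apart.\<close>
    then have "elation_mat s \<notin> shear_coord_ball t (cmod (s - t))"
      using elation_shear_coord[OF mem] by simp
    moreover have "elation_mat s \<in> shear_coord_ball t (cmod (s - t))"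
      using elation_shear_coord[of "elation_mat s" t t] mem eq \<open>s \<noteq> t\<close> by simp
    ultimately show False by simp
  qed
qed simp

section \<open>The square lattice of elations and its discreteness\<close>

definition lattice_pts :: "real \<Rightarrow> complex set" where
  "lattice_pts e = {Complex (e * of_int a) (e * of_int b) | a b. True}"

definition elation_lattice :: "real \<Rightarrow> (complex^3^3) set set" where
  "elation_lattice e = elation ` lattice_pts e"

lemma lattice_pts_closed:
  "0 \<in> lattice_pts e" "s \<in> lattice_pts e \<Longrightarrow> - s \<in> lattice_pts e"
  "s \<in> lattice_pts e \<Longrightarrow> t \<in> lattice_pts e \<Longrightarrow> s + t \<in> lattice_pts e"
proof -
  show "0 \<in> lattice_pts e"
    unfolding lattice_pts_def by (auto intro!: exI[of _ 0] simp: complex_eq_iff)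
  show "- s \<in> lattice_pts e" if s: "s \<in> lattice_pts e" for s
  proof -
    obtain a b where "s = Complex (e * of_int a) (e * of_int b)" using s by (auto simp: lattice_pts_def)
    then have "- s = Complex (e * of_int (- a)) (e * of_int (- b))" by (simp add: complex_eq_iff)
    then show ?thesis unfolding lattice_pts_def by blast
  qed
  show "s + t \<in> lattice_pts e" if s: "s \<in> lattice_pts e" and t: "t \<in> lattice_pts e" for s t
  proof -
    obtain a b where a: "s = Complex (e * of_int a) (e * of_int b)" using s by (auto simp: lattice_pts_def)
    obtain c d where c: "t = Complex (e * of_int c) (e * of_int d)" using t by (auto simp: lattice_pts_def)
    have "s + t = Complex (e * of_int (a + c)) (e * of_int (b + d))"
      using a c by (simp add: complex_eq_iff algebra_simps)
    then show ?thesis unfolding lattice_pts_def by blast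
  qed
qed

lemma lattice_pts_bounded_finite:
  assumes e: "e > 0"
  shows "finite {t \<in> lattice_pts e. cmod t < r}"
proof -
  define N where "N = \<lceil>r / e\<rceil>"
  have "{t \<in> lattice_pts e. cmod t < r} \<subseteq>
      (\<lambda>(a, b). Complex (e * of_int a) (e * of_int b)) ` ({- N..N} \<times> {- N..N})"
  proof
    fix t assume "t \<in> {t \<in> lattice_pts e. cmod t < r}"
    then obtain a b where t: "t = Complex (e * of_int a) (e * of_int b)" "cmod t < r"
      by (auto simp: lattice_pts_def)
    have bound: "k \<in> {- N..N}" if "\<bar>e * of_int k\<bar> < r" for k :: int
    proof -
      have "\<bar>of_int k :: real\<bar> < r / e" using that e by (simp add: abs_mult field_simps)
      then have "\<bar>k\<bar> \<le> N" unfolding N_def by linarith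
      then show ?thesis by auto
    qed
    have "\<bar>e * of_int a\<bar> < r" "\<bar>e * of_int b\<bar> < r"
      using abs_Re_le_cmod[of t] abs_Im_le_cmod[of t] t by auto
    with t show "t \<in> (\<lambda>(a, b). Complex (e * of_int a) (e * of_int b)) ` ({- N..N} \<times> {- N..N})"
      using bound[of a] bound[of b] by force
  qed
  then show ?thesis by (rule finite_subset) auto
qed

text \<open>Distinct lattice points differ by at least \<open>e\<close> in the real or in the
  imaginary part.\<close>

lemma lattice_pts_separated:
  assumes e: "e > 0" and s: "s \<in> lattice_pts e" and t: "t \<in> lattice_pts e" and lt: "cmod (s - t) < e"
  shows "s = t"
proof -
  obtain a b where a: "s = Complex (e * of_int a) (e * of_int b)" using s by (auto simp: lattice_pts_def)
  obtain c d where c: "t = Complex (e * of_int c) (e * of_int d)" using t by (auto simp: lattice_pts_def)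
  have eq: "m = n" if "\<bar>e * of_int m - e * of_int n\<bar> < e" for m n :: int
  proof -
    have "e * of_int m - e * of_int n = e * of_int (m - n)" by (simp add: right_diff_distrib)
    then have "e * \<bar>of_int (m - n)\<bar> < e * 1" using that e by (simp add: abs_mult)
    then have "\<bar>of_int (m - n) :: real\<bar> < 1" using e mult_less_cancel_left_pos by blast
    then show ?thesis by linarith
  qed
  show ?thesis
    using abs_Re_le_cmod[of "s - t"] abs_Im_le_cmod[of "s - t"] lt eq[of a c] eq[of b d]
    by (simp add: a c)
qed

lemma lattice_pts_infinite:
  assumes "e > 0"
  shows "infinite (lattice_pts e)"
proof -
  have "inj (\<lambda>a. Complex (e * of_int a) 0)" using assms by (auto simp: inj_on_def)
  then have "infinite (range (\<lambda>a. Complex (e * of_int a) 0))"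
    using infinite_UNIV_int finite_imageD by blast
  moreover have "range (\<lambda>a. Complex (e * of_int a) 0) \<subseteq> lattice_pts e"
  proof
    fix t assume "t \<in> range (\<lambda>a. Complex (e * of_int a) 0)"
    then obtain a where "t = Complex (e * of_int a) (e * of_int 0)" by auto
    then show "t \<in> lattice_pts e" unfolding lattice_pts_def by blast
  qed
  ultimately show ?thesis using finite_subset by blast
qed

lemma subgroup_elation_lattice: "subgroup (elation_lattice e) PSL3"
proof (rule group.subgroupI[OF group_PSL3])
  show "elation_lattice e \<subseteq> carrier PSL3" by (auto simp: elation_lattice_def)
  show "elation_lattice e \<noteq> {}" using lattice_pts_closed(1)[of e] by (auto simp: elation_lattice_def)
qed (auto simp: elation_lattice_def elation_inv elation_mult intro: lattice_pts_closed)

lemma elation_lattice_generate: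
  "generate PSL3 {elation (complex_of_real e), elation (\<i> * complex_of_real e)} = elation_lattice e"
proof
  let ?S = "{elation (complex_of_real e), elation (\<i> * complex_of_real e)}"
  interpret group PSL3 by (rule group_PSL3)
  have S: "?S \<subseteq> carrier PSL3" by simp
  have "complex_of_real e = Complex (e * of_int 1) (e * of_int 0)"
    "\<i> * complex_of_real e = Complex (e * of_int 0) (e * of_int 1)" by (simp_all add: complex_eq_iff)
  then have "?S \<subseteq> elation_lattice e"
    unfolding elation_lattice_def lattice_pts_def by blast
  then show "generate PSL3 ?S \<subseteq> elation_lattice e"
    by (rule generate_subgroup_incl[OF _ subgroup_elation_lattice])
  have sub: "subgroup (generate PSL3 ?S) PSL3" using S by (rule generate_is_subgroup)
  show "elation_lattice e \<subseteq> generate PSL3 ?S"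
  proof
    fix g assume "g \<in> elation_lattice e"
    then obtain a b where "g = elation (Complex (e * of_int a) (e * of_int b))"
      by (auto simp: elation_lattice_def lattice_pts_def)
    also have "Complex (e * of_int a) (e * of_int b) =
        of_int a * complex_of_real e + of_int b * (\<i> * complex_of_real e)"
      by (simp add: complex_eq_iff)
    finally have g: "g = elation (complex_of_real e) [^]\<^bsub>PSL3\<^esub> a \<otimes>\<^bsub>PSL3\<^esub>
        elation (\<i> * complex_of_real e) [^]\<^bsub>PSL3\<^esub> b"
      by (simp only: elation_int_pow elation_mult)
    have "x [^]\<^bsub>PSL3\<^esub> (k :: int) \<in> generate PSL3 ?S" if "x \<in> ?S" for x k
      using subgroup_int_pow_closed[OF sub generate.incl[OF that]] .
    then show "g \<in> generate PSL3 ?S"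
      unfolding g by (intro subgroup.m_closed[OF sub]) blast+
  qed
qed

lemma open_shear_coord_ball: "open (shear_coord_ball t r)"
  unfolding shear_coord_ball_def by (intro open_Collect_less continuous_intros)

text \<open>The classes meeting \<open>shear_coord_ball t e\<close> form an open set, and by the
  separation of lattice points it contains no lattice elation besides the one with parameter
  \<open>t\<close>.\<close>

lemma discrete_elation_lattice:
  assumes e: "e > 0"
  shows "discrete_subgroup (elation_lattice e)"
  unfolding discrete_subgroup_def
proof (intro conjI subgroup_elation_lattice, rule sym, subst discrete_topology_unique, intro conjI ballI)
  have sub: "elation_lattice e \<subseteq> carrier PSL3"
    using subgroup_elation_lattice by (rule subgroup.subset)
  have "openin PSL3_top {psl_class A | A. det A = 1 \<and> A \<in> (UNIV :: (complex^3^3) set)}"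
    by (rule openin_PSL3_top_Collect) simp
  moreover have "{psl_class A | A. det A = 1 \<and> A \<in> (UNIV :: (complex^3^3) set)} = carrier PSL3"
    by (auto simp: carrier_PSL3)
  ultimately have "carrier PSL3 \<subseteq> topspace PSL3_top" by (metis openin_subset)
  with sub show "topspace (subtopology PSL3_top (elation_lattice e)) = elation_lattice e"
    by (auto simp: topspace_subtopology)
  fix g assume "g \<in> elation_lattice e"
  then obtain t where t: "t \<in> lattice_pts e" "g = elation t" by (auto simp: elation_lattice_def)
  define U where "U = {psl_class A | A. det A = 1 \<and> A \<in> shear_coord_ball t e}"
  have "openin PSL3_top U"
    unfolding U_def by (intro openin_PSL3_top_Collect open_shear_coord_ball)
  moreover have "{g} = U \<inter> elation_lattice e"
  proof (intro equalityI subsetI)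
    fix h assume "h \<in> {g}"
    moreover have "elation_mat t \<in> elation t" by (simp add: elation_def self_mem_psl_class)
    then have "elation_mat t \<in> shear_coord_ball t e" using e by (simp add: elation_shear_coord)
    ultimately show "h \<in> U \<inter> elation_lattice e"
      using t by (auto simp: U_def elation_def elation_lattice_def)
  next
    fix h assume h: "h \<in> U \<inter> elation_lattice e"
    then obtain A where A: "h = psl_class A" "A \<in> shear_coord_ball t e" by (auto simp: U_def)
    obtain s where s: "s \<in> lattice_pts e" "h = elation s" using h by (auto simp: elation_lattice_def)
    have "A \<in> elation s" using A s self_mem_psl_class by metis
    then have "cmod (s - t) < e" using A elation_shear_coord by blast
    then have "s = t" using lattice_pts_separated e s t by blast
    with s t show "h \<in> {g}" by simp
  qed
  ultimately show "openin (subtopology PSL3_top (elation_lattice e)) {g}"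
    by (auto simp: openin_subtopology)
qed

section \<open>The lattice is not virtually cyclic\<close>

lemma (in group) finite_index_pow:
  assumes fin: "finite_index_subgroup H G" and x: "x \<in> carrier G"
  shows "\<exists>n>0. x [^] (n :: nat) \<in> H"
proof -
  have H: "subgroup H G" "finite (rcosets H)" using fin by (auto simp: finite_index_subgroup_def)
  have "range (\<lambda>n :: nat. H #> x [^] n) \<subseteq> rcosets H"
    using x by (auto simp: RCOSETS_def)
  \<comment> \<open>Pigeonhole: infinitely many exponents, finitely many cosets. The quotient of two
    powers in the same coset lies in \<open>H\<close>.\<close>
  then have "\<not> inj (\<lambda>n :: nat. H #> x [^] n)"
    using H(2) finite_subset finite_imageD infinite_UNIV_nat by metis
  then obtain i j :: nat where "i \<noteq> j" "H #> x [^] i = H #> x [^] j" by (auto simp: inj_on_def)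
  then obtain m n :: nat where mn: "m < n" "H #> x [^] m = H #> x [^] n"
    using linorder_neqE_nat by metis
  have "x [^] n \<in> H #> x [^] m"
    unfolding mn(2) using x by (intro rcos_self H) auto
  then obtain h where h: "h \<in> H" "x [^] n = h \<otimes> x [^] m" by (auto simp: r_coset_def)
  have "x [^] n = x [^] (n - m) \<otimes> x [^] m"
    using x mn(1) by (simp add: nat_pow_mult)
  moreover have "h \<in> carrier G" using h H subgroup.subset by blast
  ultimately have "x [^] (n - m) = h" using h(2) x right_cancel by (metis nat_pow_closed)
  with h mn show ?thesis by (intro exI[of _ "n - m"]) auto
qed

text \<open>A cyclic subgroup of finite index would contain positive multiples of both lattice
  generators, which are linearly independent over the reals and so cannot both be multiples of one
  vector.\<close>

lemma elation_lattice_not_virtually_cyclic: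
  assumes e: "e > 0"
  shows "\<not> virtually_cyclic (PSL3\<lparr>carrier := elation_lattice e\<rparr>)"
proof
  interpret P: group PSL3 by (rule group_PSL3)
  let ?G = "PSL3\<lparr>carrier := elation_lattice e\<rparr>"
  interpret G: group ?G using P.subgroup_imp_group[OF subgroup_elation_lattice] .
  assume "virtually_cyclic ?G"
  then obtain H where fin: "finite_index_subgroup H ?G" and cyc: "cyclic_group (PSL3\<lparr>carrier := H\<rparr>)"
    by (auto simp: virtually_cyclic_def)
  have HG: "subgroup H ?G" using fin by (simp add: finite_index_subgroup_def)
  then have H: "subgroup H PSL3" using P.incl_subgroup[OF subgroup_elation_lattice] by blast
  interpret H: group "PSL3\<lparr>carrier := H\<rparr>" using P.subgroup_imp_group[OF H] .
  obtain x where x: "x \<in> H" "H = range (\<lambda>n :: int. x [^]\<^bsub>PSL3\<^esub> n)"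
    using cyc P.int_pow_consistent[OF H] by (fastforce simp: H.cyclic_group)
  have "x \<in> elation_lattice e" using HG x(1) subgroup.subset by fastforce
  then obtain a b where ab: "x = elation (Complex (e * of_int a) (e * of_int b))"
    by (auto simp: elation_lattice_def lattice_pts_def)
  have ex: "\<exists>n k. n > 0 \<and> of_nat n * t = of_int k * Complex (e * of_int a) (e * of_int b)"
    if t: "t \<in> lattice_pts e" for t
  proof -
    have "elation t \<in> carrier ?G" using t by (simp add: elation_lattice_def)
    then obtain n :: nat where n: "n > 0" "elation t [^]\<^bsub>?G\<^esub> n \<in> H"
      using G.finite_index_pow[OF fin] by blast
    then have "elation (of_nat n * t) \<in> H"
      by (simp add: elation_nat_pow flip: P.nat_pow_consistent)
    then obtain k :: int where "elation (of_nat n * t) = x [^]\<^bsub>PSL3\<^esub> k" using x(2) by blast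
    then show ?thesis using n(1) by (auto simp: ab elation_int_pow elation_inj)
  qed
  have "Complex (e * of_int 1) (e * of_int 0) \<in> lattice_pts e"
    "Complex (e * of_int 0) (e * of_int 1) \<in> lattice_pts e"
    unfolding lattice_pts_def by blast+
  from this[THEN ex] obtain n k m l where
    n: "n > 0" "of_nat n * Complex (e * of_int 1) (e * of_int 0) =
      of_int k * Complex (e * of_int a) (e * of_int b)" and
    m: "m > 0" "of_nat m * Complex (e * of_int 0) (e * of_int 1) =
      of_int l * Complex (e * of_int a) (e * of_int b)"
    by blast
  \<comment> \<open>Here ka = n > 0 and kb = 0 force b = 0, against lb = m > 0.\<close>
  from n e have "real n = of_int k * of_int a" "of_int k * of_int b = (0 :: real)"
    by (auto simp: complex_eq_iff)
  moreover from m e have "real m = of_int l * of_int b"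
    by (auto simp: complex_eq_iff)
  ultimately show False using n(1) m(1) by auto
qed

section \<open>The Kulkarni limit set of the lattice\<close>

lemma proj_pt_eq_iff: "proj_pt v = proj_pt w \<longleftrightarrow> (\<exists>c. c \<noteq> 0 \<and> v = c *s w)"
proof
  assume "proj_pt v = proj_pt w"
  moreover have "v \<in> proj_pt v" unfolding proj_pt_def by (auto intro!: exI[of _ 1])
  ultimately show "\<exists>c. c \<noteq> 0 \<and> v = c *s w" by (auto simp: proj_pt_def)
next
  assume "\<exists>c. c \<noteq> 0 \<and> v = c *s w"
  then obtain c where c: "c \<noteq> 0" "v = c *s w" by blast
  have "d *s v = (d * c) *s w" "d *s w = (d / c) *s v" for d using c by simp_all
  then show "proj_pt v = proj_pt w"
    unfolding proj_pt_def using c by (smt (verit) Collect_cong divide_eq_0_iff mult_eq_0_iff)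
qed

text \<open>A set closed under nonzero scalars is saturated, so it is its own preimage under the
  projection to the plane.\<close>

lemma openin_P2_cone:
  assumes "open S" "0 \<notin> S" and cone: "\<And>c v. c \<noteq> 0 \<Longrightarrow> v \<in> S \<Longrightarrow> c *s v \<in> S"
  shows "openin P2_top (proj_pt ` S)"
proof -
  have "v \<in> proj_pt v" for v unfolding proj_pt_def by (auto intro!: exI[of _ 1])
  then have "\<Union>(proj_pt ` S) = S"
    using cone by (auto simp: proj_pt_def)
  moreover have "openin (top_of_set (UNIV - {0})) S"
    using assms(1,2) by (subst openin_open) auto
  moreover have "proj_pt ` S \<subseteq> P2" using assms(2) by (auto simp: P2_def)
  ultimately show ?thesis by (simp add: openin_P2_top)
qed

lemma topspace_P2_top: "topspace P2_top = P2"
proof (rule antisym)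
  show "topspace P2_top \<subseteq> P2"
    using openin_topspace[of P2_top] unfolding openin_P2_top by blast
  have "openin P2_top (proj_pt ` (UNIV - {0}))"
    by (rule openin_P2_cone) (auto simp: open_delete)
  then show "P2 \<subseteq> topspace P2_top" using openin_subset unfolding P2_def by blast
qed

lemma P2_cases:
  assumes "p \<in> P2"
  obtains v where "v \<noteq> 0" "p = proj_pt v"
  using assms by (auto simp: P2_def)

lemma vec3_eq_iff: "v = w \<longleftrightarrow> v $ 1 = w $ 1 \<and> v $ 2 = w $ 2 \<and> v $ 3 = w $ 3" for v w :: "'a^3"
  by (simp add: vec_eq_iff forall_3)

text \<open>In a T1 space every neighbourhood of a limit point meets the set in infinitely many
  points. This lets the finiteness of strip returns bound the derived sets in
  \<open>Kul_L1\<close>.\<close>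

lemma t1_space_P2: "t1_space P2_top"
  unfolding t1_space_closedin_singleton topspace_P2_top
proof
  fix p assume p: "p \<in> P2"
  then obtain w where w: "w \<noteq> 0" "p = proj_pt w" by (rule P2_cases)
  \<comment> \<open>Some 2 x 2 minor of the pair \<open>v\<close>, \<open>w\<close> is nonzero: the
    open condition that the two vectors are not proportional.\<close>
  define S where "S = {v :: complex^3. \<exists>i j. v $ i * w $ j \<noteq> v $ j * w $ i}"
  have "S = (\<Union>i. \<Union>j. {v. v $ i * w $ j \<noteq> v $ j * w $ i})" by (auto simp: S_def)
  also have "open \<dots>" by (intro open_UN ballI open_Collect_neq continuous_intros)
  finally have "open S" .
  moreover have "c *s v \<in> S" if c: "c \<noteq> 0" and v: "v \<in> S" for c v
  proof -
    obtain i j where "v $ i * w $ j \<noteq> v $ j * w $ i" using v by (auto simp: S_def)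
    then have "c * (v $ i * w $ j) \<noteq> c * (v $ j * w $ i)" using c by simp
    then have "(c *s v) $ i * w $ j \<noteq> (c *s v) $ j * w $ i" by (simp add: mult.assoc)
    then show ?thesis unfolding S_def by blast
  qed
  moreover have "0 \<notin> S" by (simp add: S_def)
  ultimately have "openin P2_top (proj_pt ` S)" using openin_P2_cone by blast
  moreover have "proj_pt ` S = P2 - {p}"
  proof (intro equalityI subsetI)
    fix q assume "q \<in> proj_pt ` S"
    then obtain v where v: "v \<in> S" "q = proj_pt v" by blast
    have "c *s w \<notin> S" for c by (simp add: S_def)
    then have "q \<noteq> p" using v unfolding w(2) by (metis proj_pt_eq_iff)
    moreover have "v \<noteq> 0" using v(1) by (auto simp: S_def)
    ultimately show "q \<in> P2 - {p}" using v(2) by (auto simp: P2_def)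
  next
    fix q assume "q \<in> P2 - {p}"
    then obtain v where v: "v \<noteq> 0" "q = proj_pt v" "q \<noteq> p" by (auto simp: P2_def)
    obtain j where j: "w $ j \<noteq> 0" using w(1) by (auto simp: vec_eq_iff)
    have "v \<in> S"
    proof (rule ccontr)
      assume "v \<notin> S"
      then have "v $ i = v $ j / w $ j * w $ i" for i
      proof -
        have "v $ i * w $ j = v $ j * w $ i" using \<open>v \<notin> S\<close> unfolding S_def by blast
        with j show ?thesis by (simp add: nonzero_eq_divide_eq)
      qed
      then have eq: "v = (v $ j / w $ j) *s w"
        unfolding vec_eq_iff vector_smult_component by blast
      then have "v $ j / w $ j \<noteq> 0" using v(1) by (metis vector_smult_lzero)
      with eq have "proj_pt v = proj_pt w" unfolding proj_pt_eq_iff by blast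
      with v w show False by simp
    qed
    with v show "q \<in> proj_pt ` S" by blast
  qed
  ultimately show "closedin P2_top {p}" using p by (simp add: closedin_def topspace_P2_top)
qed

section \<open>Strips in the affine chart and the proper action of the lattice\<close>

definition line_at_infinity :: "(complex^3) set set" where
  "line_at_infinity = {p \<in> P2. \<exists>v. p = proj_pt v \<and> v $ 3 = 0}"

text \<open>In the chart z = 1 this is |x| < r with y free. Elations move only x, so bounding that
  coordinate suffices for properness, and the strips still exhaust the chart.\<close>

definition affine_strip :: "real \<Rightarrow> (complex^3) set set" where
  "affine_strip r = proj_pt ` {v. cmod (v $ 1) < r * cmod (v $ 3)}"

lemma proj_pt_in_line_at_infinity:
  assumes "v \<noteq> 0"
  shows "proj_pt v \<in> line_at_infinity \<longleftrightarrow> v $ 3 = 0"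
proof
  assume "proj_pt v \<in> line_at_infinity"
  then show "v $ 3 = 0" by (auto simp: line_at_infinity_def proj_pt_eq_iff)
next
  assume "v $ 3 = 0"
  with assms show "proj_pt v \<in> line_at_infinity" unfolding line_at_infinity_def P2_def by blast
qed

lemma affine_strip_scale:
  assumes "c \<noteq> 0"
  shows "cmod ((c *s v) $ 1) < r * cmod ((c *s v) $ 3) \<longleftrightarrow> cmod (v $ 1) < r * cmod (v $ 3)"
proof -
  have "cmod ((c *s v) $ 1) < r * cmod ((c *s v) $ 3) \<longleftrightarrow>
      cmod c * cmod (v $ 1) < cmod c * (r * cmod (v $ 3))"
    by (simp only: vector_smult_component norm_mult mult.left_commute)
  with assms show ?thesis by simp
qed

lemma openin_affine_strip: "openin P2_top (affine_strip r)"
  unfolding affine_strip_def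
proof (rule openin_P2_cone)
  show "open {v :: complex^3. cmod (v $ 1) < r * cmod (v $ 3)}"
    by (intro open_Collect_less continuous_intros)
  show "c *s v \<in> {v. cmod (v $ 1) < r * cmod (v $ 3)}"
    if "c \<noteq> 0" "v \<in> {v. cmod (v $ 1) < r * cmod (v $ 3)}" for c v
    using that affine_strip_scale[OF that(1)] by blast
qed simp

lemma mem_affine_strip: "proj_pt v \<in> affine_strip r \<longleftrightarrow> cmod (v $ 1) < r * cmod (v $ 3)"
proof
  assume "proj_pt v \<in> affine_strip r"
  then obtain c w where "c \<noteq> 0" "v = c *s w" "cmod (w $ 1) < r * cmod (w $ 3)"
    by (auto simp: affine_strip_def proj_pt_eq_iff)
  then show "cmod (v $ 1) < r * cmod (v $ 3)" using affine_strip_scale by blast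
qed (simp add: affine_strip_def)

lemma closedin_line_at_infinity: "closedin P2_top line_at_infinity"
proof -
  have "openin P2_top (proj_pt ` {v. v $ 3 \<noteq> 0})"
    by (rule openin_P2_cone) (auto intro!: open_Collect_neq continuous_intros)
  moreover have "proj_pt ` {v. v $ 3 \<noteq> 0} = P2 - line_at_infinity"
  proof -
    have "v \<noteq> 0" if "v $ 3 \<noteq> 0" for v :: "complex^3" using that by auto
    then show ?thesis
      using proj_pt_in_line_at_infinity by (auto simp: P2_def)
  qed
  moreover have "line_at_infinity \<subseteq> P2" by (auto simp: line_at_infinity_def)
  ultimately show ?thesis by (simp add: closedin_def topspace_P2_top)
qed

lemma elation_mat_vec:
  "(elation_mat t *v v) $ 1 = v $ 1 + t * v $ 3" "(elation_mat t *v v) $ 2 = v $ 2"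
  "(elation_mat t *v v) $ 3 = v $ 3"
  by (simp_all add: elation_mat_def matrix_vector_mult_def sum_3 mat_def)

lemma act_elation: "act (elation t) (proj_pt v) = proj_pt (elation_mat t *v v)"
  using act_proj[of "elation_mat t" v] by (simp add: elation_def psl_class_def)

lemma act_elation_fixed:
  assumes "v $ 3 = 0"
  shows "act (elation t) (proj_pt v) = proj_pt v"
proof -
  have "elation_mat t *v v = v" unfolding vec3_eq_iff using assms by (simp add: elation_mat_vec)
  then show ?thesis by (simp add: act_elation)
qed

text \<open>A translation by \<open>t\<close> that takes a point of |x| < r into |x| < s has |t| < r
  + s. All three parts of the Kulkarni limit set are controlled by this finiteness.\<close>

lemma finite_strip_returns:
  assumes e: "e > 0"
  shows "finite {g \<in> elation_lattice e. act g ` affine_strip r \<inter> affine_strip s \<noteq> {}}"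
proof -
  have "{g \<in> elation_lattice e. act g ` affine_strip r \<inter> affine_strip s \<noteq> {}}
      \<subseteq> elation ` {t \<in> lattice_pts e. cmod t < r + s}"
  proof
    fix g assume "g \<in> {g \<in> elation_lattice e. act g ` affine_strip r \<inter> affine_strip s \<noteq> {}}"
    then obtain t p where t: "t \<in> lattice_pts e" "g = elation t"
      and p: "p \<in> affine_strip r" "act g p \<in> affine_strip s"
      by (auto simp: elation_lattice_def)
    obtain v where v: "p = proj_pt v" "cmod (v $ 1) < r * cmod (v $ 3)"
      using p(1) by (auto simp: affine_strip_def)
    then have v3: "v $ 3 \<noteq> 0" by (auto dest: le_less_trans[OF norm_ge_zero])
    have "cmod (v $ 1 + t * v $ 3) < s * cmod (v $ 3)"
      using p(2) by (simp add: v t act_elation mem_affine_strip elation_mat_vec)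
    moreover have "cmod (t * v $ 3) \<le> cmod (v $ 1 + t * v $ 3) + cmod (v $ 1)"
      using norm_triangle_ineq4[of "v $ 1 + t * v $ 3" "v $ 1"] by simp
    ultimately have "cmod t * cmod (v $ 3) < (r + s) * cmod (v $ 3)"
      using v(2) by (simp add: norm_mult algebra_simps)
    then have "cmod t < r + s" using v3 by simp
    with t show "g \<in> elation ` {t \<in> lattice_pts e. cmod t < r + s}" by blast
  qed
  then show ?thesis
    using lattice_pts_bounded_finite[OF e] finite_surj by blast
qed

lemma P2_minus_line_strip:
  assumes "p \<in> P2 - line_at_infinity"
  obtains r where "p \<in> affine_strip r"
proof -
  obtain v where v: "v \<noteq> 0" "p = proj_pt v" using assms P2_cases by blast
  then have v3: "v $ 3 \<noteq> 0" using assms proj_pt_in_line_at_infinity by blast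
  \<comment> \<open>Adding 1 makes the defining inequality of the strip strict.\<close>
  have "cmod (v $ 1) < (cmod (v $ 1) + 1) / cmod (v $ 3) * cmod (v $ 3)" using v3 by simp
  then have "p \<in> affine_strip ((cmod (v $ 1) + 1) / cmod (v $ 3))"
    unfolding v(2) mem_affine_strip .
  then show ?thesis by (rule that)
qed

lemma affine_strip_mono:
  assumes "r \<le> s"
  shows "affine_strip r \<subseteq> affine_strip s"
proof -
  have "cmod (v $ 1) < s * cmod (v $ 3)" if "cmod (v $ 1) < r * cmod (v $ 3)" for v :: "complex^3"
    using that mult_right_mono[OF assms norm_ge_zero, of "v $ 3"] by linarith
  then show ?thesis unfolding affine_strip_def by blast
qed

text \<open>The whole lattice fixes the axis pointwise, while an element fixing a point off the axis
  returns a strip around that point to itself.\<close>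

lemma Kul_L0_elation_lattice:
  assumes e: "e > 0"
  shows "Kul_L0 (elation_lattice e) = line_at_infinity"
proof -
  have "{p \<in> P2. infinite {g \<in> elation_lattice e. act g p = p}} = line_at_infinity"
  proof (intro equalityI subsetI)
    fix p assume p: "p \<in> {p \<in> P2. infinite {g \<in> elation_lattice e. act g p = p}}"
    show "p \<in> line_at_infinity"
    proof (rule ccontr)
      assume "p \<notin> line_at_infinity"
      then obtain r where "p \<in> affine_strip r" using p P2_minus_line_strip by blast
      then have "{g \<in> elation_lattice e. act g p = p} \<subseteq>
          {g \<in> elation_lattice e. act g ` affine_strip r \<inter> affine_strip r \<noteq> {}}" by force
      with p finite_strip_returns[OF e, of r r] show False using finite_subset by blast
    qed
  next
    fix p assume p: "p \<in> line_at_infinity"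
    then obtain v where v: "p = proj_pt v" "v $ 3 = 0" by (auto simp: line_at_infinity_def)
    then have "{g \<in> elation_lattice e. act g p = p} = elation ` lattice_pts e"
      by (auto simp: elation_lattice_def act_elation_fixed)
    moreover have "inj_on elation (lattice_pts e)" by (simp add: inj_on_def elation_inj)
    ultimately have "infinite {g \<in> elation_lattice e. act g p = p}"
      using lattice_pts_infinite[OF e] finite_imageD by metis
    with p show "p \<in> {p \<in> P2. infinite {g \<in> elation_lattice e. act g p = p}}"
      by (simp add: line_at_infinity_def)
  qed
  then show ?thesis
    by (simp add: Kul_L0_def closure_of_closedin closedin_line_at_infinity)
qed

text \<open>Off the line every point has an open strip as neighbourhood, and orbits of points or
  compact sets lying in another strip meet it for finitely many elements only. As the line is
  closed, taking closures adds nothing outside it.\<close>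

lemma Kul_limit_elation_lattice:
  assumes e: "e > 0"
  shows "Kul_limit (elation_lattice e) \<subseteq> line_at_infinity"
proof -
  have "P2_top derived_set_of ((\<lambda>g. act g z) ` elation_lattice e) \<subseteq> line_at_infinity"
    if z: "z \<in> P2 - line_at_infinity" for z
  proof
    fix q assume "q \<in> P2_top derived_set_of ((\<lambda>g. act g z) ` elation_lattice e)"
    then have "q \<in> P2 \<and> (\<forall>U. q \<in> U \<and> openin P2_top U \<longrightarrow>
        infinite ((\<lambda>g. act g z) ` elation_lattice e \<inter> U))"
      unfolding t1_space_derived_set_of_infinite_openin[THEN iffD1, OF t1_space_P2, rule_format]
        topspace_P2_top by simp
    then have q: "q \<in> P2" and acc: "\<And>U. q \<in> U \<Longrightarrow> openin P2_top U \<Longrightarrow>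
        infinite ((\<lambda>g. act g z) ` elation_lattice e \<inter> U)" by blast+
    show "q \<in> line_at_infinity"
    proof (rule ccontr)
      assume "q \<notin> line_at_infinity"
      then obtain s where s: "q \<in> affine_strip s" using q P2_minus_line_strip by blast
      obtain r where r: "z \<in> affine_strip r" using z P2_minus_line_strip by blast
      have "(\<lambda>g. act g z) ` elation_lattice e \<inter> affine_strip s \<subseteq>
          (\<lambda>g. act g z) ` {g \<in> elation_lattice e. act g ` affine_strip r \<inter> affine_strip s \<noteq> {}}"
        using r by blast
      then have "finite ((\<lambda>g. act g z) ` elation_lattice e \<inter> affine_strip s)"
        by (rule finite_subset) (intro finite_imageI finite_strip_returns e)
      with acc[OF s openin_affine_strip] show False by contradiction
    qed
  qed
  then have L1: "Kul_L1 (elation_lattice e) \<subseteq> line_at_infinity"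
    unfolding Kul_L1_def Kul_L0_elation_lattice[OF e]
    by (intro closure_of_minimal[OF UN_least closedin_line_at_infinity]) blast
  have "family_accumulation (elation_lattice e) K \<subseteq> line_at_infinity"
    if K: "compactin P2_top K" "K \<subseteq> P2 - line_at_infinity" for K
  proof
    have "\<exists>n :: nat. p \<in> affine_strip (real n)" if p: "p \<in> P2 - line_at_infinity" for p
    proof -
      obtain r where "p \<in> affine_strip r" using p P2_minus_line_strip by blast
      moreover obtain n :: nat where "r \<le> real n" using real_arch_simple by blast
      ultimately show ?thesis using affine_strip_mono by blast
    qed
    then have "K \<subseteq> \<Union>(range (\<lambda>n :: nat. affine_strip (real n)))" using K(2) by blast
    from compactinD[OF K(1) _ this]
    obtain F where F: "finite F" "F \<subseteq> range (\<lambda>n :: nat. affine_strip (real n))" "K \<subseteq> \<Union>F"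
      using openin_affine_strip by blast
    then obtain N where N: "finite N" "F = (\<lambda>n :: nat. affine_strip (real n)) ` N"
      using finite_subset_image[OF F(1,2)] by blast
    \<comment> \<open>The strips increase with their width, so the widest member of the finite
      subcover contains \<open>K\<close>. Inserting 0 keeps the set under \<open>Max\<close>
      nonempty even for an empty subcover.\<close>
    have Kbox: "K \<subseteq> affine_strip (real (Max (insert 0 N)))"
    proof
      fix p assume "p \<in> K"
      then obtain n where n: "n \<in> N" "p \<in> affine_strip (real n)" using F N by blast
      then have "real n \<le> real (Max (insert 0 N))" using N by simp
      from affine_strip_mono[OF this] n show "p \<in> affine_strip (real (Max (insert 0 N)))" by blast
    qed
    fix q assume q: "q \<in> family_accumulation (elation_lattice e) K"
    then have qP: "q \<in> P2" by (simp add: family_accumulation_def)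
    show "q \<in> line_at_infinity"
    proof (rule ccontr)
      assume "q \<notin> line_at_infinity"
      then obtain s where s: "q \<in> affine_strip s" using qP P2_minus_line_strip by blast
      then have "infinite {g \<in> elation_lattice e. act g ` K \<inter> affine_strip s \<noteq> {}}"
        using q openin_affine_strip[of s] by (simp add: family_accumulation_def)
      moreover have "{g \<in> elation_lattice e. act g ` K \<inter> affine_strip s \<noteq> {}} \<subseteq>
          {g \<in> elation_lattice e. act g ` affine_strip (real (Max (insert 0 N))) \<inter> affine_strip s \<noteq> {}}"
        using Kbox by blast
      ultimately show False
        using finite_subset[OF _ finite_strip_returns[OF e, of "real (Max (insert 0 N))" s]] by blast
    qed
  qed
  then have "Kul_L2 (elation_lattice e) \<subseteq> line_at_infinity"
    unfolding Kul_L2_def Kul_L0_elation_lattice[OF e]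
    by (intro closure_of_minimal[OF UN_least closedin_line_at_infinity]) blast
  with L1 show ?thesis
    by (simp add: Kul_limit_def Kul_L0_elation_lattice[OF e])
qed

lemma complex_Kleinian_elation_lattice:
  assumes e: "e > 0"
  shows "complex_Kleinian (elation_lattice e)"
proof -
  have "axis 3 1 \<noteq> (0 :: complex^3)" by (simp add: axis_eq_0_iff)
  then have "proj_pt (axis 3 1) \<in> P2 - line_at_infinity"
    by (simp add: proj_pt_in_line_at_infinity P2_def)
  then have "Kul_Omega (elation_lattice e) \<noteq> {}"
    using Kul_limit_elation_lattice[OF e] by (auto simp: Kul_Omega_def)
  then show ?thesis using discrete_elation_lattice[OF e] by (simp add: complex_Kleinian_def)
qed

section \<open>The lattice as a small representation, and the Schottky locus\<close>

lemma elation_small: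
  assumes "cmod t < 1 / 432"
  shows "elation t \<in> small_classes"
proof -
  have "cmod ((elation_mat t - mat 1) $ i $ j) < 1 / 432" for i j
    using assms exhaust_3[of i] exhaust_3[of j] by (auto simp: elation_mat_def mat_def)
  then show ?thesis
    unfolding small_classes_def elation_def using det_elation_mat by blast
qed

lemma small_Kleinian_rep:
  obtains \<rho> where "\<rho> \<in> Kleinian_reps" "\<rho> \<in> small_reps"
proof -
  \<comment> \<open>Any positive value below 1/432 puts both generators into
    \<open>small_classes\<close>.\<close>
  define e :: real where "e = 1 / 1000"
  have e: "e > 0" by (simp add: e_def)
  obtain \<rho> where \<rho>: "\<rho> \<in> Rep2"
    "Rep2_coords \<rho> = (elation (complex_of_real e), elation (\<i> * complex_of_real e))"
    using Rep2_coords_surj elation_closed by blast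
  then have "rep_image \<rho> = elation_lattice e"
    by (simp add: rep_image_generate elation_lattice_generate)
  then have "\<rho> \<in> Kleinian_reps"
    using \<rho>(1) complex_Kleinian_elation_lattice[OF e] elation_lattice_not_virtually_cyclic[OF e]
    by (simp add: Kleinian_reps_def)
  moreover have "\<rho> \<in> small_reps"
    using \<rho> by (simp add: small_reps_def elation_small e_def norm_mult)
  ultimately show ?thesis by (rule that)
qed

text \<open>A Schottky representation is faithful with discrete image; were it small, it would embed
  the free group in a nilpotent group.\<close>

lemma small_reps_disjoint_schottky_locus:
  assumes "schottky_locus U"
  shows "small_reps \<inter> U = {}"
proof (rule ccontr)
  assume "small_reps \<inter> U \<noteq> {}"
  then obtain \<rho> where \<rho>: "\<rho> \<in> small_reps" "\<rho> \<in> U" by blast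
  then have "inj_on \<rho> (carrier F2)" "discrete_subgroup (rep_image \<rho>)"
    using assms by (auto simp: schottky_locus_def complex_Kleinian_def)
  moreover have "\<rho> \<in> Rep2" using \<rho> by (simp add: small_reps_def)
  ultimately show False
    using discrete_small_rep_nilpotent[OF \<rho>(1)] nilpotent_rep_image_not_inj by blast
qed

theorem proposition6p2:
  shows "(\<exists>\<rho>\<^sub>0 \<in> Kleinian_reps. \<exists>V \<subseteq> Rep2.
            (\<exists>W. openin Rep2_top W \<and> \<rho>\<^sub>0 \<in> W \<and> W \<subseteq> V) \<and>
            (\<forall>\<rho> \<in> V \<inter> Kleinian_reps. nilpotent_group (PSL3\<lparr>carrier := rep_image \<rho>\<rparr>)) \<and>
            (\<forall>U. schottky_locus U \<longrightarrow> V \<inter> U = {})) \<and>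
         (\<forall>U. schottky_locus U \<longrightarrow>
            Rep2_zariski_dense U \<and> \<not> Kleinian_reps \<subseteq> Rep2_top closure_of U)"
proof (intro conjI allI impI)
  obtain \<rho> where \<rho>: "\<rho> \<in> Kleinian_reps" "\<rho> \<in> small_reps" by (rule small_Kleinian_rep)
  show "\<exists>\<rho>\<^sub>0 \<in> Kleinian_reps. \<exists>V \<subseteq> Rep2.
            (\<exists>W. openin Rep2_top W \<and> \<rho>\<^sub>0 \<in> W \<and> W \<subseteq> V) \<and>
            (\<forall>\<rho> \<in> V \<inter> Kleinian_reps. nilpotent_group (PSL3\<lparr>carrier := rep_image \<rho>\<rparr>)) \<and>
            (\<forall>U. schottky_locus U \<longrightarrow> V \<inter> U = {})"
  proof (intro bexI[OF _ \<rho>(1)] exI[of _ small_reps] conjI ballI allI impI)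
    show "small_reps \<subseteq> Rep2" by (auto simp: small_reps_def)
    show "openin Rep2_top small_reps" "\<rho> \<in> small_reps" "small_reps \<subseteq> small_reps"
      using openin_small_reps \<rho> by auto
    show "nilpotent_group (PSL3\<lparr>carrier := rep_image \<sigma>\<rparr>)" if "\<sigma> \<in> small_reps \<inter> Kleinian_reps" for \<sigma>
      using that discrete_small_rep_nilpotent by (auto simp: Kleinian_reps_def complex_Kleinian_def)
    show "small_reps \<inter> U = {}" if "schottky_locus U" for U
      using that by (rule small_reps_disjoint_schottky_locus)
  qed
  fix U assume U: "schottky_locus U"
  then show "Rep2_zariski_dense U"
    by (intro open_imp_zariski_dense) (auto simp: schottky_locus_def)
  \<comment> \<open>\<open>small_reps\<close> is an open neighbourhood of \<open>\<rho>\<close> that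
    misses \<open>U\<close>.\<close>
  have "\<rho> \<notin> Rep2_top closure_of U"
    using small_reps_disjoint_schottky_locus[OF U] openin_small_reps \<rho>(2)
    by (auto simp: in_closure_of)
  with \<rho>(1) show "\<not> Kleinian_reps \<subseteq> Rep2_top closure_of U" by blast
qed

end
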